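(* Let $\rho$ be a probability distribution on $\mathcal S$. The function $f_\rho:\Pi\to\mathbb R$, $f_\rho(\pi)=\mathbb E_{s\sim\rho}[V^\pi_r(s)]$, is differentiable (in the sense of the context) at every point of its domain $\Pi$ except on a set of zero $(|\mathcal A|-1)|\mathcal S|$-dimensional Hausdorff measure.
   Context: Robust MDP. $\mathcal S,\mathcal A$ are finite nonempty state and action sets, $c:\mathcal S\times\mathcal A\to\mathbb R$ is a cost with $0<c(s,a)\le1$, $\gamma\in(0,1)$ is the discount factor, and $\mathbb P_{N}$ is a nominal transition kernel ($\mathbb P_N(\cdot|s,a)\in\Delta_{\mathcal S}$, the probability simplex). The uncertainty set $\mathcal U\subset\mathbb R^{|\mathcal S|\times|\mathcal S|\times|\mathcal A|}$ is nonempty, compact and $(s,a)$-rectangular: $\mathcal U=\prod_{s,a}\mathcal U_{s,a}$ with $\mathcal U_{s,a}=\{u(\cdot|s,a):u\in\mathcal U\}$; for every $u\in\mathcal U$, $\mathbb P_u(\cdot|s,a)=\mathbb P_N(\cdot|s,a)+u(\cdot|s,a)$ is a transition kernel. $\Pi\subset\mathbb R^{|\mathcal S||\mathcal A|}$ is the set of stationary randomized policies ($\pi(\cdot|s)\in\Delta_{\mathcal A}$ for all $s$). $V^\pi_u(s)=\mathbb E[\sum_{t\ge0}\gamma^t c(s_t,a_t)\mid s_0=s]$ with $a_t\sim\pi(\cdot|s_t)$, $s_{t+1}\sim\mathbb P_u(\cdot|s_t,a_t)$; $V^\pi_r(s)=\max_{u\in\mathcal U}V^\pi_u(s)$. Differentiability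 (direct parameterization). A function $f:\Pi\to\mathbb R$ is differentiable at $\pi\in\Pi$ if there is a vector $\nabla f(\pi)\in\mathbb R^{|\mathcal S||\mathcal A|}$, called a policy gradient, with $$\lim_{\delta\to0,\ \pi+\delta\in\Pi}\ \frac{|f(\pi+\delta)-f(\pi)-\langle\nabla f(\pi),\delta\rangle|}{\|\delta\|_2}=0 .$$ *)

theory Defs
  imports "HOL-Probability.Probability"
begin

definition prob_simplex :: "(real ^ 'n::finite) set" where
  "prob_simplex = {x. (\<forall>i. 0 \<le> x $ i) \<and> (\<Sum>i\<in>UNIV. x $ i) = 1}"

(* The pmf with the given weights; only meaningful for x in prob_simplex. *)
definition vec_pmf :: "real ^ 'n::finite \<Rightarrow> 'n pmf" where
  "vec_pmf x = embed_pmf (\<lambda>i. x $ i)"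

(* Transition functions and perturbations are indexed as P $ s $ a $ s' = P(s'|s,a),
   policies as p $ s $ a = p(a|s).  The inner product and norm of the nested vector types are
   the Euclidean ones of the flattened spaces. *)

type_synonym ('s, 'a) kernel = "real ^ 's ^ 'a ^ 's"
type_synonym ('s, 'a) policy = "real ^ 'a ^ 's"

definition transition_kernel :: "('s::finite, 'a::finite) kernel \<Rightarrow> bool" where
  "transition_kernel P \<longleftrightarrow> (\<forall>s a. P $ s $ a \<in> prob_simplex)"

definition policies :: "('s::finite, 'a::finite) policy set" where
  "policies = {p. \<forall>s. p $ s \<in> prob_simplex}"

(* U is the product of its projections U_{s,a} = {u(.|s,a) : u \<in> U}. *)
definition sa_rectangular :: "('s::finite, 'a::finite) kernel set \<Rightarrow> bool" where
  "sa_rectangular U \<longleftrightarrow> U = {u. \<forall>s a. u $ s $ a \<in> (\<lambda>v. v $ s $ a) ` U}"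

(* Conditional law of (s_t, a_t) given the past h = (s_0, a_0), ..., (s_{t-1}, a_{t-1}),
   for the chain started in state s. *)
definition step_pmf ::
  "('s::finite, 'a::finite) kernel \<Rightarrow> ('s, 'a) policy \<Rightarrow> 's \<Rightarrow> nat \<Rightarrow> (nat \<Rightarrow> 's \<times> 'a) \<Rightarrow> ('s \<times> 'a) pmf"
where
  "step_pmf P p s t h =
     bind_pmf
       (case t of 0 \<Rightarrow> return_pmf s | Suc k \<Rightarrow> vec_pmf (P $ fst (h k) $ snd (h k)))
       (\<lambda>s'. map_pmf (\<lambda>a'. (s', a')) (vec_pmf (p $ s')))"

lemma Ionescu_Tulcea_step_pmf:
  "Ionescu_Tulcea (\<lambda>t h. measure_pmf (step_pmf P p s t h)) (\<lambda>_. count_space UNIV)"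
proof (rule Ionescu_Tulcea.intro)
  fix t :: nat and h
  show "prob_space (measure_pmf (step_pmf P p s t h))"
    by (rule prob_space_measure_pmf)
  show "(\<lambda>h. measure_pmf (step_pmf P p s t h))
      \<in> measurable (PiM {0..<t} (\<lambda>_. count_space UNIV)) (subprob_algebra (count_space UNIV))"
  proof (cases t)
    case 0
    then show ?thesis
      by (simp add: step_pmf_def measure_pmf_in_subprob_algebra)
  next
    case (Suc k)
    have "(\<lambda>x. measure_pmf (step_pmf P p s t (\<lambda>_. x)))
        \<in> measurable (count_space UNIV) (subprob_algebra (count_space UNIV))"
      by (simp add: measure_pmf_in_subprob_algebra)
    moreover have "(\<lambda>h. h k) \<in> measurable (PiM {0..<t} (\<lambda>_. count_space UNIV)) (count_space UNIV)"
      using Suc by (intro measurable_component_singleton) simp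
    ultimately have "(\<lambda>h. measure_pmf (step_pmf P p s t (\<lambda>_. h k)))
        \<in> measurable (PiM {0..<t} (\<lambda>_. count_space UNIV)) (subprob_algebra (count_space UNIV))"
      by (rule measurable_compose[rotated])
    then show ?thesis
      by (simp add: step_pmf_def Suc)
  qed
qed

(* Law of the trajectory (s_t, a_t)_{t \<ge> 0}: the Ionescu-Tulcea extension of the steps above. *)
definition trajectory ::
  "('s::finite, 'a::finite) kernel \<Rightarrow> ('s, 'a) policy \<Rightarrow> 's \<Rightarrow> (nat \<Rightarrow> 's \<times> 'a) measure"
where
  "trajectory P p s =
     projective_family.lim UNIV
       (Ionescu_Tulcea.CI (\<lambda>t h. measure_pmf (step_pmf P p s t h)) (\<lambda>_. count_space UNIV))
       (\<lambda>_. count_space UNIV)"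

definition policy_value ::
  "('s::finite \<Rightarrow> 'a::finite \<Rightarrow> real) \<Rightarrow> real \<Rightarrow> ('s, 'a) kernel \<Rightarrow> ('s, 'a) policy \<Rightarrow> 's \<Rightarrow> real"
where
  "policy_value c \<gamma> P p s =
     (\<integral>\<omega>. (\<Sum>t. \<gamma> ^ t * c (fst (\<omega> t)) (snd (\<omega> t))) \<partial>trajectory P p s)"

(* The supremum is a maximum when U is nonempty and compact and every PN + u with u in U is a
   transition kernel, because the value is then continuous in u. *)
definition robust_value ::
  "('s::finite \<Rightarrow> 'a::finite \<Rightarrow> real) \<Rightarrow> real \<Rightarrow> ('s, 'a) kernel \<Rightarrow> ('s, 'a) kernel set
     \<Rightarrow> ('s, 'a) policy \<Rightarrow> 's \<Rightarrow> real"
where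
  "robust_value c \<gamma> PN U p s = (SUP u\<in>U. policy_value c \<gamma> (PN + u) p s)"

definition robust_objective ::
  "('s::finite \<Rightarrow> 'a::finite \<Rightarrow> real) \<Rightarrow> real \<Rightarrow> ('s, 'a) kernel \<Rightarrow> ('s, 'a) kernel set
     \<Rightarrow> 's pmf \<Rightarrow> ('s, 'a) policy \<Rightarrow> real"
where
  "robust_objective c \<gamma> PN U \<rho> p = measure_pmf.expectation \<rho> (robust_value c \<gamma> PN U p)"

(* Differentiability at p relative to the policy set: f is only evaluated at policies. *)
definition is_policy_gradient ::
  "(('s::finite, 'a::finite) policy \<Rightarrow> real) \<Rightarrow> ('s, 'a) policy \<Rightarrow> ('s, 'a) policy \<Rightarrow> bool"
where
  "is_policy_gradient f p g \<longleftrightarrow>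
     ((\<lambda>\<delta>. \<bar>f (p + \<delta>) - f p - g \<bullet> \<delta>\<bar> / norm \<delta>) \<longlongrightarrow> 0) (at 0 within {\<delta>. p + \<delta> \<in> policies})"

definition policy_differentiable ::
  "(('s::finite, 'a::finite) policy \<Rightarrow> real) \<Rightarrow> ('s, 'a) policy \<Rightarrow> bool"
where
  "policy_differentiable f p \<longleftrightarrow> (\<exists>g. is_policy_gradient f p g)"

(* d-th power of the diameter, with the conventions diam({})^d = 0 and diam(A)^0 = 1 for
   nonempty A (recall 0 ^ 0 = 1), so that the 0-dimensional measure counts points. *)
definition diam_pow :: "nat \<Rightarrow> 'm::metric_space set \<Rightarrow> ennreal" where
  "diam_pow d A = (if A = {} then 0 else ennreal (diameter A ^ d))"

(* Boundedness of the covering sets is required explicitly because the library's diameter is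
   an unspecified real number on unbounded sets. *)
definition hausdorff_pre_measure :: "nat \<Rightarrow> real \<Rightarrow> 'm::metric_space set \<Rightarrow> ennreal" where
  "hausdorff_pre_measure d \<epsilon> A =
     (INF C\<in>{C :: nat \<Rightarrow> 'm set. A \<subseteq> (\<Union>i. C i) \<and> (\<forall>i. bounded (C i) \<and> diameter (C i) \<le> \<epsilon>)}.
        \<Sum>i. diam_pow d (C i))"

(* d-dimensional Hausdorff (outer) measure, without the normalising constant that makes it
   agree with Lebesgue measure on R^d. *)
definition hausdorff_measure :: "nat \<Rightarrow> 'm::metric_space set \<Rightarrow> ennreal" where
  "hausdorff_measure d A = (SUP \<epsilon>\<in>{0<..}. hausdorff_pre_measure d \<epsilon> A)"

end

(* For fixed s, the robust value is the maximum over the compact set U of the functions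
   p |-> V^p_u(s), whose derivatives are bounded and which satisfy a first-order expansion in p with
   a quadratic error, both uniformly in u.  By Danskin's theorem such a maximum is differentiable at
   p, relative to the policy set, unless two maximisers have different gradients along some vector b of
   an orthonormal basis of the d-dimensional tangent space, d = (|A|-1)|S|.  Fix b and separate the two
   derivatives by rationals r < s.  Within a small ball, the set of such p cannot contain two points
   whose difference is close to the direction b, so it is a Lipschitz graph over the d - 1 other
   coordinates, and covering it by O(N^(d-1)) pieces of diameter O(1/N) shows that it is null.
   Countably many such sets suffice. *)
theory Submission
  imports Defs
begin

section \<open>Null sets of the Hausdorff measure\<close>

text \<open>A route through Rademacher's theorem would have to identify the policy polytope with a
  full-dimensional body and to compare Hausdorff with Lebesgue measure. The family of values has
  more structure: the uniform quadratic error makes the maximum semiconvex, and the singularities of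
  such functions lie on countably many graphs of codimension one. Seeing this takes only differences
  of points, so boundary policies are treated like all others. The cone condition behind the graphs
  comes from adding the optimality of one maximiser at p to that of another at q: the function
  values cancel, and the gradients turn out to be monotone up to a multiple of |q - p|^2. The
  quadratic error is not found by differentiating the series twice. A value difference and its
  linear part solve two discounted equations with the same source, and their discrepancy solves a
  third one whose source is a product of two small quantities. Trajectories enter only through their
  one-time marginals, since the cost is additive in time.\<close>

lemma hausdorff_measure_eq_0_iff:
  "hausdorff_measure d A = 0 \<longleftrightarrow> (\<forall>\<epsilon>>0. \<forall>\<eta>>0. \<exists>C :: nat \<Rightarrow> _.
     A \<subseteq> (\<Union>i. C i) \<and> (\<forall>i. bounded (C i) \<and> diameter (C i) \<le> \<epsilon>) \<and> (\<Sum>i. diam_pow d (C i)) < ennreal \<eta>)"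
proof -
  have "hausdorff_measure d A = 0 \<longleftrightarrow> (\<forall>\<epsilon>>0. hausdorff_pre_measure d \<epsilon> A = 0)"
    unfolding hausdorff_measure_def bot_ennreal[symmetric] by (subst SUP_bot_conv) auto
  also have "\<dots> \<longleftrightarrow> (\<forall>\<epsilon>>0. \<forall>\<eta>>0. hausdorff_pre_measure d \<epsilon> A < ennreal \<eta>)"
  proof -
    have "x = 0 \<longleftrightarrow> (\<forall>\<eta>>0. x < ennreal \<eta>)" for x :: ennreal
    proof
      assume *: "\<forall>\<eta>>0. x < ennreal \<eta>"
      have "x \<le> 0"
      proof (rule ennreal_le_epsilon)
        fix e :: real assume "0 < e"
        with * show "x \<le> 0 + ennreal e" by (auto simp: less_imp_le)
      qed
      then show "x = 0" by simp
    qed auto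
    then show ?thesis by metis
  qed
  finally show ?thesis
    unfolding hausdorff_pre_measure_def INF_less_iff by (simp add: Bex_def conj_assoc)
qed

lemma hausdorff_measure_eq_0_subset:
  assumes "hausdorff_measure d B = 0" "A \<subseteq> B"
  shows "hausdorff_measure d A = 0"
  using assms unfolding hausdorff_measure_eq_0_iff by (meson order_trans)

lemma hausdorff_measure_empty [simp]: "hausdorff_measure d {} = 0"
  unfolding hausdorff_measure_eq_0_iff
  by (auto intro!: exI[of _ "\<lambda>_. {}"] simp: diam_pow_def diameter_def)

text \<open>Countable subadditivity for null sets: the n-th set receives a geometric share of
  \<eta>, and the doubly indexed covers are merged into one sequence by the pairing
  function.\<close>

lemma hausdorff_measure_eq_0_UN_nat:
  fixes A :: "nat \<Rightarrow> 'm::metric_space set"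
  assumes null: "\<And>n. hausdorff_measure d (A n) = 0"
  shows "hausdorff_measure d (\<Union>n. A n) = 0"
  unfolding hausdorff_measure_eq_0_iff
proof (intro allI impI)
  fix \<epsilon> \<eta> :: real assume pos: "\<epsilon> > 0" "\<eta> > 0"
  \<comment> \<open>The shares add up to \<eta>/2 only: the strict bounds become a weak one in the
    infinite sum, and \<eta>/2 < \<eta> restores strictness.\<close>
  have "\<exists>C :: nat \<Rightarrow> _. A n \<subseteq> (\<Union>i. C i) \<and> (\<forall>i. bounded (C i) \<and> diameter (C i) \<le> \<epsilon>) \<and>
      (\<Sum>i. diam_pow d (C i)) < ennreal (\<eta> / 2 * (1/2) ^ Suc n)" for n
    using null[of n] pos unfolding hausdorff_measure_eq_0_iff by simp
  then obtain C :: "nat \<Rightarrow> nat \<Rightarrow> 'm set" where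
    C: "\<And>n. A n \<subseteq> (\<Union>i. C n i)" "\<And>n i. bounded (C n i)" "\<And>n i. diameter (C n i) \<le> \<epsilon>"
       "\<And>n. (\<Sum>i. diam_pow d (C n i)) < ennreal (\<eta> / 2 * (1/2) ^ Suc n)"
    by metis
  define D where "D = (\<lambda>k. case prod_decode k of (n, i) \<Rightarrow> C n i)"
  have "(\<Union>n. A n) \<subseteq> (\<Union>k. D k)"
  proof
    fix x assume "x \<in> (\<Union>n. A n)"
    then obtain n i where "x \<in> C n i" using C(1) by blast
    then have "x \<in> D (prod_encode (n, i))" by (simp add: D_def)
    then show "x \<in> (\<Union>k. D k)" by blast
  qed
  moreover have "bounded (D k) \<and> diameter (D k) \<le> \<epsilon>" for k
    using C by (simp add: D_def split: prod.split)
  moreover have "(\<Sum>k. diam_pow d (D k)) < ennreal \<eta>"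
  proof -
    have "(\<Sum>k. diam_pow d (D k)) = (\<Sum>n. \<Sum>i. diam_pow d (C n i))"
      using suminf_ennreal_2dimen[of "\<lambda>n. \<Sum>i. diam_pow d (C n i)" "\<lambda>(n, i). diam_pow d (C n i)"]
      by (simp add: D_def case_prod_unfold)
    also have "\<dots> \<le> (\<Sum>n. ennreal (\<eta> / 2 * (1/2) ^ Suc n))"
      by (intro suminf_le less_imp_le C) auto
    also have "\<dots> = ennreal (\<eta> / 2)"
    proof (rule suminf_ennreal_eq)
      show "(\<lambda>n. \<eta> / 2 * (1/2) ^ Suc n) sums (\<eta> / 2)"
        using sums_mult[OF power_half_series, of "\<eta> / 2"] by simp
    qed (use pos in auto)
    also have "\<dots> < ennreal \<eta>" using pos by (simp add: ennreal_less_iff)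
    finally show ?thesis .
  qed
  ultimately show "\<exists>C :: nat \<Rightarrow> _. (\<Union>n. A n) \<subseteq> (\<Union>i. C i) \<and>
      (\<forall>i. bounded (C i) \<and> diameter (C i) \<le> \<epsilon>) \<and> (\<Sum>i. diam_pow d (C i)) < ennreal \<eta>"
    by blast
qed

lemma hausdorff_measure_eq_0_UN:
  assumes "countable I" and "\<And>i. i \<in> I \<Longrightarrow> hausdorff_measure d (A i) = 0"
  shows "hausdorff_measure d (\<Union>i\<in>I. A i) = 0"
proof (cases "I = {}")
  case False
  then have "(\<Union>i\<in>I. A i) = (\<Union>n. A (from_nat_into I n))"
    using range_from_nat_into[OF False assms(1)] by (metis image_image)
  then show ?thesis
    using hausdorff_measure_eq_0_UN_nat[of d "\<lambda>n. A (from_nat_into I n)"] assms(2) from_nat_into[OF False]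
    by simp
qed simp

section \<open>Null sets from finite covers and from a small number of coordinates\<close>

lemma hausdorff_measure_eq_0_finite_cover:
  fixes A :: "'m::metric_space set"
  assumes "\<And>\<epsilon> \<eta> :: real. \<epsilon> > 0 \<Longrightarrow> \<eta> > 0 \<Longrightarrow> \<exists>\<C>. finite \<C> \<and> A \<subseteq> \<Union>\<C> \<and>
      (\<forall>C\<in>\<C>. bounded C \<and> diameter C \<le> \<epsilon>) \<and> (\<Sum>C\<in>\<C>. diameter C ^ d) < \<eta>"
  shows "hausdorff_measure d A = 0"
  unfolding hausdorff_measure_eq_0_iff
proof (intro allI impI)
  fix \<epsilon> \<eta> :: real assume pos: "\<epsilon> > 0" "\<eta> > 0"
  from assms[OF this] obtain \<C> where \<C>: "finite \<C>" "A \<subseteq> \<Union>\<C>"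
    "\<And>C. C \<in> \<C> \<Longrightarrow> bounded C \<and> diameter C \<le> \<epsilon>" "(\<Sum>C\<in>\<C>. diameter C ^ d) < \<eta>"
    by blast
  obtain h where h: "bij_betw h {0..<card \<C>} \<C>"
    using ex_bij_betw_nat_finite[OF \<C>(1)] by blast
  \<comment> \<open>Padding by empty sets costs nothing: \<open>diam_pow d {}\<close> is 0 even for
    d = 0, where a zero diameter alone would contribute \<open>0 ^ 0 = 1\<close>.\<close>
  define C where "C = (\<lambda>i. if i < card \<C> then h i else {})"
  have im: "h i \<in> \<C>" if "i < card \<C>" for i
    using h that by (auto simp: bij_betw_def)
  have "A \<subseteq> (\<Union>i. C i)"
  proof
    fix x assume "x \<in> A"
    then obtain Y where "Y \<in> \<C>" "x \<in> Y" using \<C> by blast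
    then obtain i where "i < card \<C>" "h i = Y"
      using bij_betw_imp_surj_on[OF h] by (metis atLeastLessThan_iff imageE)
    then show "x \<in> (\<Union>i. C i)" using \<open>x \<in> Y\<close> by (auto simp: C_def intro!: exI[of _ i])
  qed
  moreover have "bounded (C i) \<and> diameter (C i) \<le> \<epsilon>" for i
    using \<C>(3)[OF im] pos by (cases "i < card \<C>") (simp_all add: C_def)
  moreover have "(\<Sum>i. diam_pow d (C i)) < ennreal \<eta>"
  proof -
    have "(\<Sum>i. diam_pow d (C i)) = (\<Sum>i<card \<C>. diam_pow d (h i))"
      by (subst suminf_finite[of "{..<card \<C>}"]) (auto simp: C_def diam_pow_def)
    also have "\<dots> = (\<Sum>Y\<in>\<C>. diam_pow d Y)"
      using sum.reindex_bij_betw[OF h, of "diam_pow d"] by (simp add: lessThan_atLeast0)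
    also have "\<dots> \<le> (\<Sum>Y\<in>\<C>. ennreal (diameter Y ^ d))"
      by (intro sum_mono) (auto simp: diam_pow_def)
    also have "\<dots> = ennreal (\<Sum>Y\<in>\<C>. diameter Y ^ d)"
      using \<C>(3) by (intro sum_ennreal) (auto intro!: zero_le_power diameter_ge_0)
    also have "\<dots> < ennreal \<eta>"
      using \<C>(4) pos by (simp add: ennreal_less_iff sum_nonneg ennreal_lessI)
    finally show ?thesis .
  qed
  ultimately show "\<exists>C :: nat \<Rightarrow> _. A \<subseteq> (\<Union>i. C i) \<and>
      (\<forall>i. bounded (C i) \<and> diameter (C i) \<le> \<epsilon>) \<and> (\<Sum>i. diam_pow d (C i)) < ennreal \<eta>"
    by blast
qed

text \<open>The hypothesis \<open>lip\<close> says that the coordinate map is injective on F with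
  Lipschitz inverse. That inverse lives only on the image of F, so grid cells are pulled back to F:
  a piece is the set of points with the same rounded coordinates.\<close>

lemma hausdorff_measure_eq_0_few_coordinates:
  fixes F :: "'m::metric_space set" and \<phi> :: "'i \<Rightarrow> 'm \<Rightarrow> real"
  assumes I: "finite I" "card I < d"
    and bnd: "\<And>i p. i \<in> I \<Longrightarrow> p \<in> F \<Longrightarrow> \<bar>\<phi> i p\<bar> \<le> B"
    and lip: "\<And>p q. p \<in> F \<Longrightarrow> q \<in> F \<Longrightarrow> dist p q \<le> K * (\<Sum>i\<in>I. \<bar>\<phi> i p - \<phi> i q\<bar>)"
  shows "hausdorff_measure d F = 0"
proof (rule hausdorff_measure_eq_0_finite_cover)
  fix \<epsilon> \<eta> :: real assume pos: "\<epsilon> > 0" "\<eta> > 0"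
  \<comment> \<open>Requiring b >= 1 lets the 2Nb + 1 integers in [-Nb, Nb] be counted by 3Nb, and
    makes this base at least 1, so that the exponent can be raised from \<open>card I\<close> to d -
    1.\<close>
  obtain b :: nat where b: "B \<le> real b" "1 \<le> b"
    by (metis max.cobounded1 max.cobounded2 order_trans real_arch_simple of_nat_le_iff)
  \<comment> \<open>Equal roundings at mesh 1/N put each coordinate within 1/N, so R/N bounds the
    diameter of a piece; the summand 1 keeps R positive when K or \<open>card I\<close>
    vanishes.\<close>
  define R where "R = \<bar>K\<bar> * real (card I) + 1"
  have R: "R > 0" by (simp add: R_def add_nonneg_pos)
  \<comment> \<open>Chosen so that (number of pieces) * (diameter)^d, namely (3bN)^(d-1) * (R/N)^d,
    equals T/N.\<close>
  define T where "T = (3 * real b) ^ (d - 1) * R ^ d"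
  have T: "T > 0" using R b by (simp add: T_def)
  obtain N :: nat where N: "max (R / \<epsilon>) (T / \<eta>) < real N" using reals_Archimedean2 by blast
  have "0 < R / \<epsilon>" using R pos by simp
  with N have N0: "real N > 0" by linarith
  have RN: "R / real N \<le> \<epsilon>" "T / real N < \<eta>"
    using N N0 pos by (auto simp: field_simps)
  define k where "k = (\<lambda>p. \<lambda>i\<in>I. \<lfloor>real N * \<phi> i p\<rfloor>)"
  define S where "S = {- int (N * b) .. int (N * b)}"
  define \<C> where "\<C> = (\<lambda>x. {p \<in> F. k p = x}) ` (PiE I (\<lambda>_. S))"
  have finP: "finite (PiE I (\<lambda>_. S))" using I by (intro finite_PiE) (auto simp: S_def)
  have kS: "k p \<in> PiE I (\<lambda>_. S)" if "p \<in> F" for p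
  proof -
    have "\<lfloor>real N * \<phi> i p\<rfloor> \<in> S" if "i \<in> I" for i
    proof -
      have "\<bar>\<phi> i p\<bar> \<le> real b" using bnd[OF that \<open>p \<in> F\<close>] b by linarith
      then have "\<bar>real N * \<phi> i p\<bar> \<le> real N * real b" by (simp add: abs_mult mult_left_mono)
      then have "- real (N * b) \<le> real N * \<phi> i p" "real N * \<phi> i p \<le> real (N * b)"
        by (auto simp: abs_le_iff)
      then show ?thesis unfolding S_def atLeastAtMost_iff by linarith
    qed
    then show ?thesis by (auto simp: k_def)
  qed
  have cl: "dist p q \<le> R / real N" if "p \<in> F" "q \<in> F" "k p = k q" for p q
  proof -
    have "\<bar>\<phi> i p - \<phi> i q\<bar> \<le> 1 / real N" if "i \<in> I" for i
    proof -
      have "\<lfloor>real N * \<phi> i p\<rfloor> = \<lfloor>real N * \<phi> i q\<rfloor>"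
        using fun_cong[OF \<open>k p = k q\<close>, of i] that by (simp add: k_def)
      then have "\<bar>real N * \<phi> i p - real N * \<phi> i q\<bar> \<le> 1" by linarith
      then have "real N * \<bar>\<phi> i p - \<phi> i q\<bar> \<le> 1"
        using N0 by (simp add: right_diff_distrib[symmetric] abs_mult)
      then show ?thesis using N0 by (simp add: field_simps)
    qed
    then have "(\<Sum>i\<in>I. \<bar>\<phi> i p - \<phi> i q\<bar>) \<le> real (card I) * (1 / real N)"
      using sum_bounded_above[of I "\<lambda>i. \<bar>\<phi> i p - \<phi> i q\<bar>" "1 / real N"] by simp
    then have "\<bar>K\<bar> * (\<Sum>i\<in>I. \<bar>\<phi> i p - \<phi> i q\<bar>) \<le> \<bar>K\<bar> * (real (card I) * (1 / real N))"
      by (intro mult_left_mono) auto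
    moreover have "K * (\<Sum>i\<in>I. \<bar>\<phi> i p - \<phi> i q\<bar>) \<le> \<bar>K\<bar> * (\<Sum>i\<in>I. \<bar>\<phi> i p - \<phi> i q\<bar>)"
      by (intro mult_right_mono sum_nonneg) auto
    moreover have "\<bar>K\<bar> * (real (card I) * (1 / real N)) \<le> R / real N"
      using N0 by (simp add: R_def field_simps)
    ultimately show ?thesis using lip[OF that(1,2)] by linarith
  qed
  have dia: "diameter C \<le> R / real N" "bounded C" if C: "C \<in> \<C>" for C
  proof -
    show "diameter C \<le> R / real N"
    proof -
      have "0 \<le> R / real N" using R by simp
      moreover have "dist p q \<le> R / real N" if "p \<in> C" "q \<in> C" for p q
        using C cl that by (auto simp: \<C>_def)
      ultimately show ?thesis by (auto simp: diameter_def intro!: cSUP_least)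
    qed
    show "bounded C"
      using C cl unfolding bounded_two_points by (auto simp: \<C>_def intro!: exI[of _ "R / real N"])
  qed
  have finC: "finite \<C>" using finP by (simp add: \<C>_def)
  have cardC: "real (card \<C>) \<le> (3 * real b * real N) ^ (d - 1)"
  proof -
    have "card \<C> \<le> card (PiE I (\<lambda>_. S))" unfolding \<C>_def by (rule card_image_le[OF finP])
    also have "\<dots> = card S ^ card I" using I by (simp add: card_PiE)
    also have "\<dots> \<le> (3 * b * N) ^ card I"
    proof (rule power_mono)
      have "1 \<le> N * b" using N0 b by simp
      then have "2 * (N * b) + 1 \<le> 3 * (N * b)" by linarith
      moreover have "card S = 2 * (N * b) + 1" by (simp add: S_def nat_add_distrib nat_mult_distrib)
      ultimately show "card S \<le> 3 * b * N" by (simp add: mult_ac)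
    qed simp
    also have "\<dots> \<le> (3 * b * N) ^ (d - 1)"
      using I b N0 by (intro power_increasing) auto
    finally have "real (card \<C>) \<le> real ((3 * b * N) ^ (d - 1))" by (rule of_nat_mono)
    then show ?thesis by simp
  qed
  have "(\<Sum>C\<in>\<C>. diameter C ^ d) \<le> (\<Sum>C\<in>\<C>. (R / real N) ^ d)"
    by (intro sum_mono power_mono dia diameter_ge_0)
  also have "\<dots> = real (card \<C>) * (R / real N) ^ d" by simp
  also have "\<dots> \<le> (3 * real b * real N) ^ (d - 1) * (R / real N) ^ d"
    using cardC R by (intro mult_right_mono) auto
  also have "\<dots> = T / real N"
  proof -
    obtain e where e: "d = Suc e" using I by (cases d) auto
    show ?thesis using N0 by (simp add: T_def e power_mult_distrib power_divide field_simps)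
  qed
  also have "\<dots> < \<eta>" by (rule RN)
  finally have sum: "(\<Sum>C\<in>\<C>. diameter C ^ d) < \<eta>" .
  have cov: "F \<subseteq> \<Union>\<C>" using kS by (auto simp: \<C>_def)
  show "\<exists>\<C>. finite \<C> \<and> F \<subseteq> \<Union>\<C> \<and>
      (\<forall>C\<in>\<C>. bounded C \<and> diameter C \<le> \<epsilon>) \<and> (\<Sum>C\<in>\<C>. diameter C ^ d) < \<eta>"
    using finC cov sum dia RN(1) order_trans by (intro exI[of _ \<C>]) blast
qed

section \<open>Maxima of smooth families\<close>

text \<open>Only \<delta> has to lie in the span. The vector x, later a gradient, may have an
  orthogonal component, which the product does not see.\<close>

lemma inner_orthonormal_expand:
  fixes B :: "'e::euclidean_space set"
  assumes "finite B" "pairwise orthogonal B" "\<And>b. b \<in> B \<Longrightarrow> norm b = 1" "\<delta> \<in> span B"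
  shows "x \<bullet> \<delta> = (\<Sum>b\<in>B. (\<delta> \<bullet> b) * (x \<bullet> b))"
proof -
  have "x \<bullet> \<delta> = x \<bullet> (\<Sum>b\<in>B. (\<delta> \<bullet> b) *\<^sub>R b)"
    by (subst orthonormal_basis_expand[OF assms(2,3,4,1)]) auto
  then show ?thesis by (simp add: inner_sum_right)
qed

lemma norm_le_orthonormal_sum:
  fixes B :: "'e::euclidean_space set"
  assumes "finite B" "pairwise orthogonal B" "\<And>b. b \<in> B \<Longrightarrow> norm b = 1" "\<delta> \<in> span B"
  shows "norm \<delta> \<le> (\<Sum>b\<in>B. \<bar>\<delta> \<bullet> b\<bar>)"
proof -
  have "norm \<delta> = norm (\<Sum>b\<in>B. (\<delta> \<bullet> b) *\<^sub>R b)"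
    by (subst orthonormal_basis_expand[OF assms(2,3,4,1)]) auto
  also have "\<dots> \<le> (\<Sum>b\<in>B. norm ((\<delta> \<bullet> b) *\<^sub>R b))" by (rule norm_sum)
  also have "\<dots> = (\<Sum>b\<in>B. \<bar>\<delta> \<bullet> b\<bar>)" using assms(3) by (intro sum.cong) auto
  finally show ?thesis .
qed

text \<open>The set X is seen only through pairs of its points: \<open>expand\<close> compares any
  two of them directly, without a segment or a neighbourhood inside X. The span of B contains all
  differences, so a gradient matters only through its components along B.\<close>

locale smooth_family_max =
  fixes X :: "'e::euclidean_space set" and U :: "'u::metric_space set"
    and g :: "'u \<Rightarrow> 'e \<Rightarrow> real" and D :: "'u \<Rightarrow> 'e \<Rightarrow> 'e"
    and K L :: real and B :: "'e set"
  assumes U: "compact U" "U \<noteq> {}" and K: "0 \<le> K"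
    and expand: "\<And>u p q. u \<in> U \<Longrightarrow> p \<in> X \<Longrightarrow> q \<in> X \<Longrightarrow>
      \<bar>g u q - g u p - D u p \<bullet> (q - p)\<bar> \<le> K * (norm (q - p))^2"
    and D_bound: "\<And>u p. u \<in> U \<Longrightarrow> p \<in> X \<Longrightarrow> norm (D u p) \<le> L"
    and cont_g: "\<And>p. p \<in> X \<Longrightarrow> continuous_on U (\<lambda>u. g u p)"
    and cont_D: "\<And>p. p \<in> X \<Longrightarrow> continuous_on U (\<lambda>u. D u p)"
    and B: "finite B" "pairwise orthogonal B" "\<And>b. b \<in> B \<Longrightarrow> norm b = 1"
    and tangent: "\<And>p q. p \<in> X \<Longrightarrow> q \<in> X \<Longrightarrow> q - p \<in> span B"
begin

definition upper :: "'e \<Rightarrow> real" where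
  "upper p = (SUP u\<in>U. g u p)"

definition active :: "'e \<Rightarrow> 'u set" where
  "active p = {u \<in> U. \<forall>v\<in>U. g v p \<le> g u p}"

lemma active_nonempty:
  assumes "p \<in> X" obtains u where "u \<in> active p"
proof -
  obtain u where "u \<in> U" "\<forall>v\<in>U. g v p \<le> g u p"
    using continuous_attains_sup[OF U cont_g[OF assms]] by blast
  then show thesis by (intro that[of u]) (simp add: active_def)
qed

lemma upper_active:
  assumes "u \<in> active p" shows "upper p = g u p"
  unfolding upper_def using assms by (intro cSup_eq_maximum) (auto simp: active_def)

lemma le_upper:
  assumes "v \<in> U" "p \<in> X" shows "g v p \<le> upper p"
proof -
  obtain u where u: "u \<in> active p" using active_nonempty[OF assms(2)] .
  then have "g v p \<le> g u p" using assms(1) by (simp add: active_def)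
  then show ?thesis by (simp only: upper_active[OF u])
qed

lemma L_nonneg:
  assumes "p \<in> X" shows "0 \<le> L"
proof -
  obtain u where "u \<in> U" using U(2) by blast
  from order_trans[OF norm_ge_zero D_bound[OF this assms]] show ?thesis .
qed

lemma lipschitz:
  assumes "u \<in> U" "p \<in> X" "q \<in> X"
  shows "\<bar>g u q - g u p\<bar> \<le> L * norm (q - p) + K * (norm (q - p))^2"
proof -
  have "\<bar>D u p \<bullet> (q - p)\<bar> \<le> L * norm (q - p)"
    using Cauchy_Schwarz_ineq2[of "D u p" "q - p"] D_bound[OF assms(1,2)]
    by (meson mult_right_mono norm_ge_zero order_trans)
  with expand[OF assms] show ?thesis by linarith
qed

section \<open>Danskin's theorem relative to X\<close>

text \<open>Semicontinuity of the set of maximisers. Parameters whose gradient at p is off by at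
  least e form a compact set without maximisers at p, so their values at p miss the maximum by a
  positive gap; near p the values move too little to close it. The gradients stay evaluated at p, as
  the expansion around p requires.\<close>

lemma active_gradient_near:
  assumes p: "p \<in> X" and unique: "\<And>u b. u \<in> active p \<Longrightarrow> b \<in> B \<Longrightarrow> D u p \<bullet> b = G \<bullet> b"
    and e: "e > 0"
  obtains r where "r > 0"
    "\<And>q u. q \<in> X \<Longrightarrow> norm (q - p) < r \<Longrightarrow> u \<in> active q \<Longrightarrow> (\<Sum>b\<in>B. \<bar>(D u p - G) \<bullet> b\<bar>) < e"
proof -
  define h where "h = (\<lambda>u. \<Sum>b\<in>B. \<bar>(D u p - G) \<bullet> b\<bar>)"
  define U' where "U' = U \<inter> h -` {e..}"
  obtain u0 where u0: "u0 \<in> active p" using active_nonempty[OF p] .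
  have "continuous_on U h"
    unfolding h_def by (intro continuous_intros cont_D p)
  then have cU': "compact U'"
    unfolding U'_def using U(1) by (intro closedin_compact[OF U(1)] continuous_closedin_preimage) auto
  have "\<exists>r>0. \<forall>q\<in>X. norm (q - p) < r \<longrightarrow> active q \<inter> U' = {}"
  proof (cases "U' = {}")
    case True
    then show ?thesis by (auto intro: exI[of _ 1])
  next
    case False
    have "continuous_on U' (\<lambda>u. g u p)"
      using cont_g[OF p] by (rule continuous_on_subset) (simp add: U'_def)
    from continuous_attains_sup[OF cU' False this]
    obtain u1 where u1: "u1 \<in> U'" "\<And>v. v \<in> U' \<Longrightarrow> g v p \<le> g u1 p" by blast
    have "u1 \<notin> active p"
    proof
      assume "u1 \<in> active p"
      then have "h u1 = 0" using unique by (simp add: h_def inner_diff_left)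
      with u1(1) e show False by (simp add: U'_def)
    qed
    then have less: "g u1 p < g u0 p"
      using u0 u1(1) by (fastforce simp: active_def U'_def)
    define \<kappa> where "\<kappa> = g u0 p - g u1 p"
    \<comment> \<open>Each value changes by at most (L + K) * |q - p|, as |q - p| < 1 absorbs the
      square; two such changes have to stay below the gap \<kappa>. The summand 1 in the denominator
      guards against L = K = 0.\<close>
    define r where "r = min 1 (\<kappa> / (2 * (L + K) + 1))"
    have LK: "2 * (L + K) + 1 > 0" using L_nonneg[OF p] K by simp
    have r: "r > 0" "r \<le> 1" "r * (2 * (L + K) + 1) \<le> \<kappa>"
      using less LK by (auto simp: r_def \<kappa>_def pos_le_divide_eq[symmetric])
    have "active q \<inter> U' = {}" if q: "q \<in> X" "norm (q - p) < r" for q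
    proof (rule ccontr)
      assume "active q \<inter> U' \<noteq> {}"
      then obtain u where u: "u \<in> active q" "u \<in> U'" by blast
      have uU: "u \<in> U" "u0 \<in> U" using u u0 by (auto simp: active_def)
      define n where "n = norm (q - p)"
      have "n * n \<le> 1 * n" using q(2) r(2) by (intro mult_right_mono) (auto simp: n_def)
      then have "K * n^2 \<le> K * n" using K by (simp add: power2_eq_square mult_left_mono)
      then have lip: "\<bar>g v q - g v p\<bar> \<le> (L + K) * n" if "v \<in> U" for v
        using lipschitz[OF that p q(1)] by (simp add: n_def distrib_right)
      have "g u0 q \<le> g u q" using u(1) uU by (simp add: active_def)
      with lip[OF uU(1)] lip[OF uU(2)] u1(2)[OF u(2)] have "\<kappa> \<le> 2 * ((L + K) * n)"
        unfolding \<kappa>_def by linarith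
      also have "\<dots> \<le> (2 * (L + K) + 1) * n" by (simp add: distrib_right n_def)
      also have "\<dots> < (2 * (L + K) + 1) * r" using q(2) LK by (simp add: n_def)
      also have "\<dots> \<le> \<kappa>" using r(3) by (simp add: mult.commute)
      finally show False by simp
    qed
    with r(1) show ?thesis by blast
  qed
  then obtain r where r: "r > 0" "\<And>q. q \<in> X \<Longrightarrow> norm (q - p) < r \<Longrightarrow> active q \<inter> U' = {}" by blast
  have "h u < e" if "q \<in> X" "norm (q - p) < r" "u \<in> active q" for q u
    using r(2)[OF that(1,2)] that(3) by (auto simp: U'_def active_def not_le[symmetric])
  with r(1) that show thesis by (auto simp: h_def)
qed

text \<open>Two one-sided estimates: a fixed maximiser at p, followed to q, bounds the increment
  from below; a maximiser at q, followed back to p, bounds it from above, and its gradient at p is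
  close to G by the preceding lemma.\<close>

lemma upper_differentiable:
  assumes p: "p \<in> X" and unique: "\<And>u b. u \<in> active p \<Longrightarrow> b \<in> B \<Longrightarrow> D u p \<bullet> b = G \<bullet> b"
  shows "((\<lambda>\<delta>. \<bar>upper (p + \<delta>) - upper p - G \<bullet> \<delta>\<bar> / norm \<delta>) \<longlongrightarrow> 0) (at 0 within {\<delta>. p + \<delta> \<in> X})"
proof (rule tendstoI)
  fix e :: real assume e: "e > 0"
  obtain r where r: "r > 0" "\<And>q u. q \<in> X \<Longrightarrow> norm (q - p) < r \<Longrightarrow> u \<in> active q \<Longrightarrow>
      (\<Sum>b\<in>B. \<bar>(D u p - G) \<bullet> b\<bar>) < e / 3"
    using active_gradient_near[OF p unique, of "e / 3"] e by auto
  obtain u0 where u0: "u0 \<in> active p" using active_nonempty[OF p] .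
  have u0U: "u0 \<in> U" using u0 by (simp add: active_def)
  \<comment> \<open>Error budget: e/3 for the deviation of gradients and e/3 for the quadratic term,
    which leaves a third for strictness. K + 1 replaces K in the denominator to allow K = 0.\<close>
  define \<rho> where "\<rho> = min r (e / (3 * (K + 1)))"
  have \<rho>: "\<rho> > 0" using r e K by (simp add: \<rho>_def)
  have main: "\<bar>upper (p + \<delta>) - upper p - G \<bullet> \<delta>\<bar> / norm \<delta> < e"
    if \<delta>: "p + \<delta> \<in> X" "\<delta> \<noteq> 0" "norm \<delta> < \<rho>" for \<delta>
  proof -
    define q where "q = p + \<delta>"
    have q: "q \<in> X" "q - p = \<delta>" using \<delta> by (auto simp: q_def)
    have tan: "\<delta> \<in> span B" using tangent[OF p q(1)] q(2) by simp
    obtain u where u: "u \<in> active q" using active_nonempty[OF q(1)] .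
    have uU: "u \<in> U" using u by (simp add: active_def)
    \<comment> \<open>Since \<delta> lies in the span of B, agreement of the gradients along B
      controls the whole inner product.\<close>
    have dir: "\<bar>(D v p - G) \<bullet> \<delta>\<bar> \<le> norm \<delta> * (\<Sum>b\<in>B. \<bar>(D v p - G) \<bullet> b\<bar>)" for v
    proof -
      have "\<bar>\<delta> \<bullet> b * ((D v p - G) \<bullet> b)\<bar> \<le> norm \<delta> * \<bar>(D v p - G) \<bullet> b\<bar>" if "b \<in> B" for b
        using Cauchy_Schwarz_ineq2[of \<delta> b] B(3)[OF that] by (simp add: abs_mult mult_right_mono)
      then have "(\<Sum>b\<in>B. \<bar>\<delta> \<bullet> b * ((D v p - G) \<bullet> b)\<bar>) \<le> (\<Sum>b\<in>B. norm \<delta> * \<bar>(D v p - G) \<bullet> b\<bar>)"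
        by (rule sum_mono)
      then show ?thesis
        using inner_orthonormal_expand[OF B tan, of "D v p - G"] sum_abs[of "\<lambda>b. \<delta> \<bullet> b * ((D v p - G) \<bullet> b)" B]
        unfolding sum_distrib_left by linarith
    qed
    have K3: "K * (norm \<delta>)^2 \<le> e / 3 * norm \<delta>"
    proof -
      have "K * norm \<delta> \<le> (K + 1) * (e / (3 * (K + 1)))"
        using \<delta>(3) K by (intro mult_mono) (auto simp: \<rho>_def)
      also have "\<dots> = e / 3" using K by (simp add: field_simps)
      finally show ?thesis
        using mult_right_mono[of "K * norm \<delta>" "e / 3" "norm \<delta>"] by (simp add: power2_eq_square mult.assoc)
    qed
    have "(D u0 p - G) \<bullet> \<delta> = 0"
      using dir[of u0] unique[OF u0] by (simp add: inner_diff_left)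
    then have "G \<bullet> \<delta> - K * (norm \<delta>)^2 \<le> g u0 q - g u0 p"
      using expand[OF u0U p q(1)] by (simp add: q(2) inner_diff_left)
    also have "\<dots> \<le> upper q - upper p"
      using le_upper[OF u0U q(1)] upper_active[OF u0] by simp
    finally have lower: "G \<bullet> \<delta> - K * (norm \<delta>)^2 \<le> upper q - upper p" .
    have "(D u p - G) \<bullet> \<delta> \<le> e / 3 * norm \<delta>"
    proof -
      have "norm \<delta> * (\<Sum>b\<in>B. \<bar>(D u p - G) \<bullet> b\<bar>) \<le> norm \<delta> * (e / 3)"
        using less_imp_le[OF r(2)[OF q(1) _ u]] \<delta>(3)
        by (intro mult_left_mono) (auto simp: q(2) \<rho>_def)
      with dir[of u] show ?thesis unfolding mult.commute[of "e / 3"] by linarith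
    qed
    moreover have "upper q - upper p \<le> g u q - g u p"
      using le_upper[OF uU p] upper_active[OF u] by simp
    moreover have "g u q - g u p \<le> D u p \<bullet> \<delta> + K * (norm \<delta>)^2"
      using expand[OF uU p q(1)] by (simp add: q(2))
    ultimately have "\<bar>upper q - upper p - G \<bullet> \<delta>\<bar> \<le> 2 * (e / 3 * norm \<delta>)"
      using lower K3 unfolding inner_diff_left abs_le_iff by linarith
    moreover have "2 * (e / 3 * norm \<delta>) < e * norm \<delta>" using e \<delta>(2) by simp
    ultimately show ?thesis using \<delta>(2) by (simp add: q_def pos_divide_less_eq)
  qed
  show "\<forall>\<^sub>F \<delta> in at 0 within {\<delta>. p + \<delta> \<in> X}.
      dist (\<bar>upper (p + \<delta>) - upper p - G \<bullet> \<delta>\<bar> / norm \<delta>) 0 < e"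
    unfolding eventually_at using \<rho> main by (intro exI[of _ \<rho>]) auto
qed

text \<open>If \<open>q - p\<close> were too close to the direction \<open>b\<close>, following one of the two maximisers to the other
  point would exceed the maximum there.\<close>

lemma active_cone:
  assumes p: "p \<in> X" and q: "q \<in> X" and v: "v \<in> active p" and u: "u \<in> active q"
    and b: "b \<in> B" and gap: "r < s" "s < D v p \<bullet> b" "D u q \<bullet> b < r"
    and near: "norm (q - p) \<le> (s - r) / (4 * (K + 1))" and t: "0 \<le> (q - p) \<bullet> b"
  shows "(q - p) \<bullet> b \<le> (4 * L + (s - r)) / (s - r) * (\<Sum>j\<in>B - {b}. \<bar>(q - p) \<bullet> j\<bar>)"
proof -
  define \<delta> where "\<delta> = q - p"
  define E where "E = D v p - D u q"
  define w where "w = (\<Sum>j\<in>B - {b}. \<bar>\<delta> \<bullet> j\<bar>)"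
  have uv: "u \<in> U" "v \<in> U" using u v by (auto simp: active_def)
  have tan: "\<delta> \<in> span B" unfolding \<delta>_def by (rule tangent[OF p q])
  \<comment> \<open>Adding the optimality of v at p and of u at q to the two expansions cancels all
    four values; what remains is the almost-monotonicity E \<bullet> \<delta> <= 2 K
    |\<delta>|^2.\<close>
  have "g v q \<le> g u q" "g u p \<le> g v p" using u v uv by (auto simp: active_def)
  moreover have "D v p \<bullet> \<delta> - K * (norm \<delta>)^2 \<le> g v q - g v p"
    using expand[OF uv(2) p q] by (simp add: \<delta>_def)
  moreover have "- (D u q \<bullet> \<delta>) - K * (norm \<delta>)^2 \<le> g u p - g u q"
    using expand[OF uv(1) q p] by (simp add: \<delta>_def norm_minus_commute inner_diff_right)
  ultimately have E_le: "E \<bullet> \<delta> \<le> 2 * (K * (norm \<delta>)^2)"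
    by (simp add: E_def inner_diff_left)
  have "E \<bullet> \<delta> = (\<delta> \<bullet> b) * (E \<bullet> b) + (\<Sum>j\<in>B - {b}. (\<delta> \<bullet> j) * (E \<bullet> j))"
    using inner_orthonormal_expand[OF B tan, of E] sum.remove[OF B(1) b] by metis
  moreover have "\<bar>\<Sum>j\<in>B - {b}. (\<delta> \<bullet> j) * (E \<bullet> j)\<bar> \<le> 2 * L * w"
  proof -
    have "norm E \<le> 2 * L"
      using norm_triangle_ineq4[of "D v p" "D u q"] D_bound[OF uv(1) q] D_bound[OF uv(2) p]
      by (simp add: E_def)
    then have "\<bar>E \<bullet> j\<bar> \<le> 2 * L" if "j \<in> B" for j
      using Cauchy_Schwarz_ineq2[of E j] B(3)[OF that] by simp
    then have "\<bar>(\<delta> \<bullet> j) * (E \<bullet> j)\<bar> \<le> 2 * L * \<bar>\<delta> \<bullet> j\<bar>" if "j \<in> B - {b}" for j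
      using that by (simp add: abs_mult mult.commute[of "2 * L"] mult_left_mono)
    then show ?thesis
      unfolding w_def sum_distrib_left by (intro order_trans[OF sum_abs] sum_mono)
  qed
  moreover have "(\<delta> \<bullet> b) * (s - r) \<le> (\<delta> \<bullet> b) * (E \<bullet> b)"
    using t gap by (intro mult_left_mono) (auto simp: \<delta>_def E_def inner_diff_left)
  ultimately have 1: "(\<delta> \<bullet> b) * (s - r) \<le> 2 * L * w + 2 * (K * (norm \<delta>)^2)"
    using E_le by linarith
  have "norm \<delta> \<le> \<delta> \<bullet> b + w"
    using norm_le_orthonormal_sum[OF B tan] sum.remove[OF B(1) b, of "\<lambda>j. \<bar>\<delta> \<bullet> j\<bar>"] t
    by (simp add: w_def \<delta>_def)
  \<comment> \<open>The radius in \<open>near\<close> is made for this: the quadratic error is at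
    most (s - r)/2 * (\<delta> \<bullet> b + w). Half of the main term absorbs its first part, and
    doubling the rest gives the constant 4 L + (s - r).\<close>
  moreover have "2 * (K * norm \<delta>) \<le> (s - r) / 2"
  proof -
    have "K * norm \<delta> \<le> (K + 1) * ((s - r) / (4 * (K + 1)))"
      using near K by (intro mult_mono) (auto simp: \<delta>_def)
    also have "\<dots> = (s - r) / 4" using K by (simp add: field_simps)
    finally show ?thesis by simp
  qed
  ultimately have "2 * (K * norm \<delta>) * norm \<delta> \<le> (s - r) / 2 * (\<delta> \<bullet> b + w)"
    using gap K by (intro mult_mono) auto
  with 1 have "(\<delta> \<bullet> b) * (s - r) \<le> 2 * L * w + (s - r) / 2 * (\<delta> \<bullet> b + w)"
    by (simp add: power2_eq_square mult.assoc)
  then have "(\<delta> \<bullet> b) * (s - r) \<le> (4 * L + (s - r)) * w"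
  proof -
    have "t * m \<le> (4 * L + m) * w" if "t * m \<le> 2 * L * w + m / 2 * (t + w)" for t m :: real
      using that by (simp add: field_simps)
    then show ?thesis
      using \<open>(\<delta> \<bullet> b) * (s - r) \<le> 2 * L * w + (s - r) / 2 * (\<delta> \<bullet> b + w)\<close> .
  qed
  then have "\<delta> \<bullet> b \<le> (4 * L + (s - r)) * w / (s - r)"
    using gap by (simp add: pos_le_divide_eq)
  then show ?thesis by (simp add: w_def \<delta>_def)
qed

text \<open>Dropping b from the basis leaves fewer than d coordinates, which is what the counting
  lemma asks for. For d = 0 the measure counts points, but then B is empty, the index set J is empty
  too, and there is no exceptional point at all.\<close>

theorem hausdorff_measure_not_differentiable_upper:
  assumes d: "card B \<le> d"
  shows "hausdorff_measure d {p \<in> X. \<not> (\<exists>G.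
    ((\<lambda>\<delta>. \<bar>upper (p + \<delta>) - upper p - G \<bullet> \<delta>\<bar> / norm \<delta>) \<longlongrightarrow> 0) (at 0 within {\<delta>. p + \<delta> \<in> X}))} = 0"
    (is "hausdorff_measure d ?N = 0")
proof -
  obtain C :: "'e set" where C: "countable C" "\<And>Y. open Y \<Longrightarrow> Y \<noteq> {} \<Longrightarrow> \<exists>z\<in>C. z \<in> Y"
    using countable_dense_exists[where 'a = 'e] by blast
  \<comment> \<open>Half the distance allowed in \<open>active_cone\<close>, so that any two points
    of one ball are close enough.\<close>
  define \<eta> where "\<eta> = (\<lambda>r s. (s - r) / (8 * (K + 1)))"
  define F where "F = (\<lambda>(b, r, s, z). {p \<in> X \<inter> ball z (\<eta> r s).
      r < s \<and> (\<exists>u\<in>active p. D u p \<bullet> b < r) \<and> (\<exists>v\<in>active p. s < D v p \<bullet> b)})"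
  define J where "J = B \<times> (\<rat> :: real set) \<times> (\<rat> :: real set) \<times> C"
  have cJ: "countable J"
    unfolding J_def using C(1) B(1) countable_rat by (intro countable_SIGMA) (auto intro: countable_finite)
  have null: "hausdorff_measure d (F i) = 0" if i: "i \<in> J" for i
  proof -
    obtain b r s z where i_eq: "i = (b, r, s, z)" by (cases i)
    have b: "b \<in> B" using i by (simp add: J_def i_eq)
    define M where "M = (4 * L + (s - r)) / (s - r)"
    have cone: "(q - p) \<bullet> b \<le> M * (\<Sum>j\<in>B - {b}. \<bar>(q - p) \<bullet> j\<bar>)"
      if pq: "p \<in> F i" "q \<in> F i" and t: "0 \<le> (q - p) \<bullet> b" for p q
    proof -
      obtain v u where vu: "p \<in> X" "q \<in> X" "v \<in> active p" "u \<in> active q" "r < s" "s < D v p \<bullet> b" "D u q \<bullet> b < r"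
        using pq by (auto simp: F_def i_eq)
      have "norm (q - p) \<le> (s - r) / (4 * (K + 1))"
      proof -
        have "dist z p < \<eta> r s" "dist z q < \<eta> r s" using pq by (auto simp: F_def i_eq)
        then have "dist q p < \<eta> r s + \<eta> r s" by metric
        also have "\<dots> = (s - r) / (4 * (K + 1))"
        proof -
          have "x / (8 * k) + x / (8 * k) = x / (4 * k)" for x k :: real by (cases "k = 0") (auto simp: field_simps)
          then show ?thesis by (simp only: \<eta>_def)
        qed
        finally show ?thesis by (simp add: dist_norm)
      qed
      from active_cone[OF vu(1-4) b vu(5-7) this t] show ?thesis unfolding M_def .
    qed
    show ?thesis
    proof (rule hausdorff_measure_eq_0_few_coordinates[where I = "B - {b}" and \<phi> = "\<lambda>j p. p \<bullet> j"
          and B = "norm z + \<eta> r s" and K = "M + 1"])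
      show "finite (B - {b})" using B(1) by simp
      show "card (B - {b}) < d"
        using d b B(1) by (meson card_Diff1_less less_le_trans)
      show "\<bar>p \<bullet> j\<bar> \<le> norm z + \<eta> r s" if "j \<in> B - {b}" "p \<in> F i" for j p
      proof -
        have "\<bar>p \<bullet> j\<bar> \<le> norm p" using Cauchy_Schwarz_ineq2[of p j] B(3) that by simp
        moreover have "dist z p < \<eta> r s" using that by (simp add: F_def i_eq)
        then have "norm p \<le> norm z + \<eta> r s"
          using norm_triangle_ineq2[of p z] by (simp add: dist_norm norm_minus_commute)
        ultimately show ?thesis by linarith
      qed
      fix p q assume pq: "p \<in> F i" "q \<in> F i"
      define w where "w = (\<Sum>j\<in>B - {b}. \<bar>p \<bullet> j - q \<bullet> j\<bar>)"
      have w: "(\<Sum>j\<in>B - {b}. \<bar>(q - p) \<bullet> j\<bar>) = w" "(\<Sum>j\<in>B - {b}. \<bar>(p - q) \<bullet> j\<bar>) = w"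
        by (simp_all add: w_def inner_diff_left abs_minus_commute)
      \<comment> \<open>Every point of \<open>F i\<close> has maximisers on both sides of the gap,
        so the cone estimate applies to the pair in either order; one of the orders has a
        nonnegative component along b.\<close>
      have "\<bar>(q - p) \<bullet> b\<bar> \<le> M * w"
        using cone[OF pq] cone[OF pq(2,1)] unfolding w by (simp add: inner_diff_left abs_if)
      moreover have "norm (q - p) \<le> \<bar>(q - p) \<bullet> b\<bar> + w"
      proof -
        have "q - p \<in> span B" using pq by (intro tangent) (auto simp: F_def i_eq)
        from norm_le_orthonormal_sum[OF B this] show ?thesis
          unfolding sum.remove[OF B(1) b] w .
      qed
      ultimately show "dist p q \<le> (M + 1) * (\<Sum>j\<in>B - {b}. \<bar>p \<bullet> j - q \<bullet> j\<bar>)"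
        by (simp add: dist_norm norm_minus_commute distrib_right flip: w_def)
    qed
  qed
  have "?N \<subseteq> (\<Union>i\<in>J. F i)"
  proof
    fix p assume "p \<in> ?N"
    then have p: "p \<in> X" and nd: "\<And>G. \<not> ((\<lambda>\<delta>. \<bar>upper (p + \<delta>) - upper p - G \<bullet> \<delta>\<bar> / norm \<delta>) \<longlongrightarrow> 0)
      (at 0 within {\<delta>. p + \<delta> \<in> X})" by auto
    obtain u0 where u0: "u0 \<in> active p" using active_nonempty[OF p] .
    \<comment> \<open>The gradient of u0 is a candidate for G; since it fails, another maximiser
      disagrees with it along some basis vector.\<close>
    obtain u1 b where u1: "u1 \<in> active p" "b \<in> B" "D u1 p \<bullet> b \<noteq> D u0 p \<bullet> b"
      using upper_differentiable[OF p] nd by blast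
    obtain u v where uv: "u \<in> active p" "v \<in> active p" "D u p \<bullet> b < D v p \<bullet> b"
      using u0 u1 by (meson linorder_neq_iff)
    obtain r where r: "r \<in> \<rat>" "D u p \<bullet> b < r" "r < D v p \<bullet> b" using Rats_dense_in_real[OF uv(3)] by blast
    obtain s where s: "s \<in> \<rat>" "r < s" "s < D v p \<bullet> b" using Rats_dense_in_real[OF r(3)] by blast
    have "\<eta> r s > 0" using s(2) K by (simp add: \<eta>_def)
    then obtain z where "z \<in> C" "z \<in> ball p (\<eta> r s)" using C(2)[of "ball p (\<eta> r s)"] by auto
    then have "(b, r, s, z) \<in> J" "p \<in> F (b, r, s, z)"
      using p r s uv u1(2) by (auto simp: J_def F_def dist_commute)
    then show "p \<in> (\<Union>i\<in>J. F i)" by blast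
  qed
  with hausdorff_measure_eq_0_UN[OF cJ null] show ?thesis
    by (rule hausdorff_measure_eq_0_subset)
qed

end

section \<open>The law of a trajectory\<close>

lemma pmf_vec_pmf:
  assumes "x \<in> prob_simplex"
  shows "pmf (vec_pmf x) i = x $ i"
  unfolding vec_pmf_def
proof (rule pmf_embed_pmf)
  show "0 \<le> x $ i" for i using assms by (simp add: prob_simplex_def)
  have "(\<integral>\<^sup>+i. ennreal (x $ i) \<partial>count_space UNIV) = (\<Sum>i\<in>UNIV. ennreal (x $ i))"
    by (simp add: nn_integral_count_space_finite)
  also have "\<dots> = ennreal (\<Sum>i\<in>UNIV. x $ i)"
    using assms by (intro sum_ennreal) (simp add: prob_simplex_def)
  finally show "(\<integral>\<^sup>+i. ennreal (x $ i) \<partial>count_space UNIV) = 1"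
    using assms by (simp add: prob_simplex_def)
qed

text \<open>A step at time t + 1 reads only the pair at time t, so a constant history stands for the
  whole past; at time 0 the history is not read, and \<open>undefined\<close> is harmless.\<close>

primrec marginal_pmf ::
  "('s::finite, 'a::finite) kernel \<Rightarrow> ('s, 'a) policy \<Rightarrow> 's \<Rightarrow> nat \<Rightarrow> ('s \<times> 'a) pmf"
where
  "marginal_pmf P p s 0 = step_pmf P p s 0 (\<lambda>_. undefined)"
| "marginal_pmf P p s (Suc t) = bind_pmf (marginal_pmf P p s t) (\<lambda>x. step_pmf P p s (Suc t) (\<lambda>_. x))"

text \<open>The measure \<open>C 0 (Suc t)\<close> of the first t + 1 pairs arises by appending one
  step at a time, and the pair at time t is the one appended last. Integrals of functions of that
  pair are therefore computed by induction on t and then transferred to the projective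
  limit.\<close>

lemma distr_trajectory:
  fixes P :: "('s::finite, 'a::finite) kernel"
  shows "distr (trajectory P p s) (count_space UNIV) (\<lambda>\<omega>. \<omega> t) = measure_pmf (marginal_pmf P p s t)"
proof -
  interpret IT: Ionescu_Tulcea "\<lambda>t h. measure_pmf (step_pmf P p s t h)" "\<lambda>_. count_space UNIV"
    by (rule Ionescu_Tulcea_step_pmf)
  have comp: "(\<lambda>\<omega>. \<omega> t) \<in> measurable (PiM {0..<Suc t} (\<lambda>_. count_space UNIV)) (count_space UNIV)" for t
    by (intro measurable_component_singleton) simp
  \<comment> \<open>The product over the empty index set has this function as its only point; it is
    the initial history.\<close>
  have undef: "(\<lambda>_. undefined :: 's \<times> 'a) \<in> space (PiM {0..<0::nat} (\<lambda>_. count_space UNIV))"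
    by (simp add: space_PiM)
  have sets_C: "sets (IT.C 0 t (\<lambda>_. undefined)) = sets (PiM {0..<t} (\<lambda>_. count_space UNIV))" for t
    using IT.sets_C[OF undef, of t] by (simp only: add_0)
  have space_C: "space (IT.C 0 t (\<lambda>_. undefined)) = space (PiM {0..<t} (\<lambda>_. count_space UNIV))" for t
    by (rule sets_eq_imp_space_eq[OF sets_C])
  have compC: "(\<lambda>\<omega>. \<omega> t) \<in> measurable (IT.C 0 (Suc t) (\<lambda>_. undefined)) (count_space UNIV)" for t
    by (subst measurable_cong_sets[OF sets_C refl]) (rule comp)
  have last_step: "(\<integral>\<^sup>+\<omega>. f (\<omega> t) \<partial>IT.C 0 (Suc t) (\<lambda>_. undefined)) =
      (\<integral>\<^sup>+\<omega>. \<integral>\<^sup>+x. f x \<partial>step_pmf P p s t \<omega> \<partial>IT.C 0 t (\<lambda>_. undefined))" for f :: "_ \<Rightarrow> ennreal" and t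
  proof -
    have fm: "(\<lambda>\<omega>. f (\<omega> t)) \<in> borel_measurable (PiM {0..<Suc t} (\<lambda>_. count_space UNIV))"
      by (rule measurable_compose[OF comp]) simp
    have "(\<integral>\<^sup>+\<omega>. f (\<omega> t) \<partial>IT.C 0 (Suc t) (\<lambda>_. undefined)) =
        (\<integral>\<^sup>+\<omega>. \<integral>\<^sup>+\<omega>'. f (\<omega>' t) \<partial>IT.eP t \<omega> \<partial>IT.C 0 t (\<lambda>_. undefined))"
    proof -
      have "IT.eP t \<in> measurable (IT.C 0 t (\<lambda>_. undefined)) (subprob_algebra (PiM {0..<Suc t} (\<lambda>_. count_space UNIV)))"
        by (subst measurable_cong_sets[OF sets_C refl]) (rule IT.measurable_eP)
      from nn_integral_bind[OF fm this] show ?thesis by (simp only: IT.C.simps add_0)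
    qed
    also have "\<dots> = (\<integral>\<^sup>+\<omega>. \<integral>\<^sup>+x. f x \<partial>step_pmf P p s t \<omega> \<partial>IT.C 0 t (\<lambda>_. undefined))"
    proof (rule nn_integral_cong)
      fix \<omega> assume "\<omega> \<in> space (IT.C 0 t (\<lambda>_. undefined))"
      then have "\<omega> \<in> space (PiM {0..<t} (\<lambda>_. count_space UNIV))" by (simp only: space_C)
      from IT.nn_integral_eP[OF this fm]
      show "(\<integral>\<^sup>+\<omega>'. f (\<omega>' t) \<partial>IT.eP t \<omega>) = (\<integral>\<^sup>+x. f x \<partial>step_pmf P p s t \<omega>)" by simp
    qed
    finally show ?thesis .
  qed
  have C: "(\<integral>\<^sup>+\<omega>. f (\<omega> t) \<partial>IT.C 0 (Suc t) (\<lambda>_. undefined)) = (\<integral>\<^sup>+x. f x \<partial>marginal_pmf P p s t)"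
    for f :: "_ \<Rightarrow> ennreal" and t
  proof (induction t arbitrary: f)
    case 0
    have "(\<integral>\<^sup>+\<omega>. \<integral>\<^sup>+x. f x \<partial>step_pmf P p s 0 \<omega> \<partial>IT.C 0 0 (\<lambda>_. undefined)) =
        (\<integral>\<^sup>+\<omega>. \<integral>\<^sup>+x. f x \<partial>marginal_pmf P p s 0 \<partial>IT.C 0 0 (\<lambda>_. undefined))"
      by (rule nn_integral_cong) (simp only: step_pmf_def marginal_pmf.simps nat.case)
    also have "\<dots> = (\<integral>\<^sup>+x. f x \<partial>marginal_pmf P p s 0)"
      using prob_space.emeasure_space_1[OF IT.prob_space_C[OF undef, of 0]]
      by (simp only: nn_integral_const mult_1_right)
    finally show ?case unfolding last_step .
  next
    case (Suc t)
    have "(\<integral>\<^sup>+\<omega>. f (\<omega> (Suc t)) \<partial>IT.C 0 (Suc (Suc t)) (\<lambda>_. undefined)) =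
        (\<integral>\<^sup>+\<omega>. \<integral>\<^sup>+x. f x \<partial>step_pmf P p s (Suc t) (\<lambda>_. \<omega> t) \<partial>IT.C 0 (Suc t) (\<lambda>_. undefined))"
      \<comment> \<open>The step depends on \<omega> only through \<open>\<omega> t\<close>, which
        turns the inner integral into a function of that pair, as the induction hypothesis
        demands.\<close>
      unfolding last_step[of "Suc t" f] by (rule nn_integral_cong) (simp only: step_pmf_def nat.case)
    also have "\<dots> = (\<integral>\<^sup>+x. f x \<partial>marginal_pmf P p s (Suc t))"
      by (subst Suc[of "\<lambda>y. \<integral>\<^sup>+x. f x \<partial>step_pmf P p s (Suc t) (\<lambda>_. y)"]) simp
    finally show ?case .
  qed
  \<comment> \<open>The marginal on the index set {t} is defined through the first
    \<open>up_to {t}\<close> coordinates; counting from 0, coordinate t needs t + 1 of them.\<close>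
  have up: "IT.up_to {t} = Suc t"
    unfolding IT.up_to_def by (rule Least_equality) (auto simp: not_less_eq_eq[symmetric])
  have lim: "trajectory P p s = IT.PF.lim"
    by (simp add: trajectory_def)
  show ?thesis
  proof (rule measure_eqI)
    show "sets (distr (trajectory P p s) (count_space UNIV) (\<lambda>\<omega>. \<omega> t)) = sets (marginal_pmf P p s t)"
      by simp
    fix A :: "('s \<times> 'a) set"
    have "distr IT.PF.lim (count_space UNIV) (\<lambda>\<omega>. \<omega> t) =
        distr (distr IT.PF.lim (PiM {t} (\<lambda>_. count_space UNIV)) (\<lambda>\<omega>. restrict \<omega> {t})) (count_space UNIV) (\<lambda>\<omega>. \<omega> t)"
      by (subst distr_distr)
        (auto intro!: measurable_component_singleton measurable_restrict_subset
          simp: comp_def measurable_cong_sets[OF IT.PF.sets_lim refl])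
    also have "\<dots> = distr (IT.CI {t}) (count_space UNIV) (\<lambda>\<omega>. \<omega> t)"
      by (simp add: IT.distr_lim)
    also have "\<dots> = distr (IT.C 0 (Suc t) (\<lambda>_. undefined)) (count_space UNIV) (\<lambda>\<omega>. \<omega> t)"
      unfolding IT.CI_def up
      by (subst distr_distr)
        (auto intro!: measurable_component_singleton measurable_restrict_subset
          simp: comp_def measurable_cong_sets[OF sets_C refl] simp del: IT.C.simps)
    finally have "emeasure (distr (trajectory P p s) (count_space UNIV) (\<lambda>\<omega>. \<omega> t)) A =
        (\<integral>\<^sup>+\<omega>. indicator A (\<omega> t) \<partial>IT.C 0 (Suc t) (\<lambda>_. undefined))"
      using nn_integral_distr[OF compC[of t], of "indicator A"] by (simp add: lim del: IT.C.simps)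
    then show "emeasure (distr (trajectory P p s) (count_space UNIV) (\<lambda>\<omega>. \<omega> t)) A = emeasure (marginal_pmf P p s t) A"
      by (simp add: C del: IT.C.simps)
  qed
qed

section \<open>Discounted values\<close>

definition transition_op :: "('s::finite \<Rightarrow> 's \<Rightarrow> real) \<Rightarrow> ('s \<Rightarrow> real) \<Rightarrow> 's \<Rightarrow> real" where
  "transition_op M h s = (\<Sum>s'\<in>UNIV. M s s' * h s')"

definition row_stochastic :: "('s::finite \<Rightarrow> 's \<Rightarrow> real) \<Rightarrow> bool" where
  "row_stochastic M \<longleftrightarrow> (\<forall>s s'. 0 \<le> M s s') \<and> (\<forall>s. (\<Sum>s'\<in>UNIV. M s s') = 1)"

text \<open>The Neumann series of the resolvent (1 - \<gamma> M)^(-1) applied to b.\<close>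

definition discounted :: "real \<Rightarrow> ('s::finite \<Rightarrow> 's \<Rightarrow> real) \<Rightarrow> ('s \<Rightarrow> real) \<Rightarrow> 's \<Rightarrow> real" where
  "discounted \<gamma> M b s = (\<Sum>t. \<gamma> ^ t * (transition_op M ^^ t) b s)"

definition policy_matrix :: "('s::finite, 'a::finite) kernel \<Rightarrow> ('s, 'a) policy \<Rightarrow> 's \<Rightarrow> 's \<Rightarrow> real" where
  "policy_matrix P p s s' = (\<Sum>a\<in>UNIV. p $ s $ a * P $ s $ a $ s')"

text \<open>A mean only if p is a policy; the same bilinear expression is also evaluated at
  differences of policies.\<close>

definition action_mean :: "('s::finite, 'a::finite) policy \<Rightarrow> ('s \<Rightarrow> 'a \<Rightarrow> real) \<Rightarrow> 's \<Rightarrow> real" where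
  "action_mean p h s = (\<Sum>a\<in>UNIV. p $ s $ a * h s a)"

section \<open>Resolvents of row-stochastic matrices\<close>

lemma prob_simplex_abs_sum_le:
  assumes "x \<in> prob_simplex" "\<And>i. \<bar>y i\<bar> \<le> \<beta>"
  shows "\<bar>\<Sum>i\<in>UNIV. x $ i * y i\<bar> \<le> \<beta>"
proof -
  have "\<bar>\<Sum>i\<in>UNIV. x $ i * y i\<bar> \<le> (\<Sum>i\<in>UNIV. x $ i * \<beta>)"
    using assms by (intro order_trans[OF sum_abs] sum_mono)
      (auto simp: prob_simplex_def abs_mult intro: mult_left_mono)
  also have "\<dots> = \<beta>" using assms by (simp add: prob_simplex_def flip: sum_distrib_right)
  finally show ?thesis .
qed

lemma transition_op_bound:
  assumes "row_stochastic M" "\<And>s. \<bar>h s\<bar> \<le> \<beta>"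
  shows "\<bar>transition_op M h s\<bar> \<le> \<beta>"
  using prob_simplex_abs_sum_le[of "\<chi> s'. M s s'" h \<beta>] assms
  by (simp add: transition_op_def row_stochastic_def prob_simplex_def)

lemma transition_op_power_bound:
  assumes "row_stochastic M" "\<And>s. \<bar>b s\<bar> \<le> \<beta>"
  shows "\<bar>(transition_op M ^^ t) b s\<bar> \<le> \<beta>"
  using assms by (induction t arbitrary: s) (auto intro: transition_op_bound)

lemma summable_discounted:
  assumes "row_stochastic M" and "0 \<le> \<gamma>" "\<gamma> < 1"
  shows "summable (\<lambda>t. \<gamma> ^ t * (transition_op M ^^ t) b s)"
proof (rule summable_comparison_test)
  have "\<bar>b s\<bar> \<le> (\<Sum>s\<in>UNIV. \<bar>b s\<bar>)" for s by (rule member_le_sum) auto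
  then have "norm (\<gamma> ^ t * (transition_op M ^^ t) b s) \<le> \<gamma> ^ t * (\<Sum>s\<in>UNIV. \<bar>b s\<bar>)" for t
    using assms by (auto simp: abs_mult intro!: mult_left_mono transition_op_power_bound)
  then show "\<exists>N. \<forall>t\<ge>N. norm (\<gamma> ^ t * (transition_op M ^^ t) b s) \<le> \<gamma> ^ t * (\<Sum>s\<in>UNIV. \<bar>b s\<bar>)"
    by blast
  show "summable (\<lambda>t. \<gamma> ^ t * (\<Sum>s\<in>UNIV. \<bar>b s\<bar>))"
    using assms by (intro summable_mult2 summable_geometric) auto
qed

lemma discounted_unfold:
  assumes "row_stochastic M" and "0 \<le> \<gamma>" "\<gamma> < 1"
  shows "discounted \<gamma> M b s = b s + \<gamma> * transition_op M (discounted \<gamma> M b) s"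
proof -
  let ?f = "\<lambda>s t. \<gamma> ^ t * (transition_op M ^^ t) b s"
  have sm: "summable (?f s)" for s by (rule summable_discounted[OF assms])
  have "discounted \<gamma> M b s = b s + (\<Sum>t. ?f s (Suc t))"
    using suminf_split_head[OF sm[of s]] by (simp add: discounted_def)
  also have "(\<lambda>t. ?f s (Suc t)) = (\<lambda>t. \<Sum>s'\<in>UNIV. \<gamma> * M s s' * ?f s' t)"
    by (simp add: transition_op_def sum_distrib_left mult_ac)
  also have "(\<Sum>t. \<Sum>s'\<in>UNIV. \<gamma> * M s s' * ?f s' t) = (\<Sum>s'\<in>UNIV. \<Sum>t. \<gamma> * M s s' * ?f s' t)"
    using sm by (intro suminf_sum summable_mult)
  also have "\<dots> = (\<Sum>s'\<in>UNIV. \<gamma> * M s s' * discounted \<gamma> M b s')"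
    unfolding discounted_def using sm by (intro sum.cong suminf_mult refl)
  also have "\<dots> = \<gamma> * transition_op M (discounted \<gamma> M b) s"
    by (simp add: transition_op_def sum_distrib_left mult_ac)
  finally show ?thesis .
qed

text \<open>At a state where |x| is maximal, say m, the equation gives m <= \<beta> + \<gamma> m.
  The bound holds for every solution x, so it also serves as a perturbation estimate for differences
  of values, whose source term is small.\<close>

lemma discount_equation_bound:
  assumes "row_stochastic M" and \<gamma>: "0 \<le> \<gamma>" "\<gamma> < 1"
    and eq: "\<And>s. x s = b s + \<gamma> * transition_op M x s"
    and b: "\<And>s. \<bar>b s\<bar> \<le> \<beta>"
  shows "\<bar>x s\<bar> \<le> \<beta> / (1 - \<gamma>)"
proof -
  define m where "m = Max (range (\<lambda>s. \<bar>x s\<bar>))"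
  have m: "\<bar>x s\<bar> \<le> m" for s by (simp add: m_def)
  have "m \<in> range (\<lambda>s. \<bar>x s\<bar>)" unfolding m_def by (rule Max_in) auto
  then obtain s0 where "m = \<bar>x s0\<bar>" by blast
  also have "\<dots> \<le> \<bar>b s0\<bar> + \<gamma> * \<bar>transition_op M x s0\<bar>"
    using eq[of s0] \<gamma> by (metis abs_mult abs_of_nonneg abs_triangle_ineq)
  also have "\<dots> \<le> \<beta> + \<gamma> * m"
    using b \<gamma> m assms(1) by (intro add_mono mult_left_mono transition_op_bound)
  finally have "m \<le> \<beta> / (1 - \<gamma>)" using \<gamma> by (simp add: field_simps)
  with m show ?thesis by (rule order_trans)
qed

lemma discounted_bound:
  assumes "row_stochastic M" "0 \<le> \<gamma>" "\<gamma> < 1" "\<And>s. \<bar>b s\<bar> \<le> \<beta>"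
  shows "\<bar>discounted \<gamma> M b s\<bar> \<le> \<beta> / (1 - \<gamma>)"
  using discount_equation_bound[OF assms(1-3) discounted_unfold[OF assms(1-3)] assms(4)] .

text \<open>The partial sums are polynomial in the matrix entries, and the geometric majorant does
  not depend on u, so the Weierstrass test applies.\<close>

lemma continuous_on_discounted:
  assumes "\<And>u. u \<in> U \<Longrightarrow> row_stochastic (M u)" and \<gamma>: "0 \<le> \<gamma>" "\<gamma> < 1"
    and cont: "\<And>s s'. continuous_on U (\<lambda>u. M u s s')"
  shows "continuous_on U (\<lambda>u. discounted \<gamma> (M u) b s)"
proof -
  let ?f = "\<lambda>t u. \<gamma> ^ t * (transition_op (M u) ^^ t) b s"
  have "uniform_limit U (\<lambda>n u. \<Sum>t<n. ?f t u) (\<lambda>u. \<Sum>t. ?f t u) sequentially"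
  proof (rule Weierstrass_m_test)
    fix t u assume "u \<in> U"
    have "\<bar>b s\<bar> \<le> (\<Sum>s\<in>UNIV. \<bar>b s\<bar>)" for s by (rule member_le_sum) auto
    then show "norm (?f t u) \<le> \<gamma> ^ t * (\<Sum>s\<in>UNIV. \<bar>b s\<bar>)"
      using assms(1)[OF \<open>u \<in> U\<close>] \<gamma>
      by (auto simp: abs_mult intro!: mult_left_mono transition_op_power_bound)
  next
    show "summable (\<lambda>t. \<gamma> ^ t * (\<Sum>s\<in>UNIV. \<bar>b s\<bar>))"
      using \<gamma> by (intro summable_mult2 summable_geometric) auto
  qed
  moreover have "continuous_on U (\<lambda>u. (transition_op (M u) ^^ t) b s)" for t s
    by (induction t arbitrary: s) (auto simp: transition_op_def intro!: continuous_intros cont)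
  then have "continuous_on U (\<lambda>u. \<Sum>t<n. ?f t u)" for n
    by (intro continuous_intros)
  ultimately show ?thesis
    unfolding discounted_def by (intro uniform_limit_theorem[where F = sequentially]) auto
qed

section \<open>From trajectories to resolvents\<close>

lemma row_stochastic_policy_matrix:
  assumes "transition_kernel P" "p \<in> policies"
  shows "row_stochastic (policy_matrix P p)"
proof -
  have "(\<Sum>s'\<in>UNIV. policy_matrix P p s s') = (\<Sum>a\<in>UNIV. p $ s $ a * (\<Sum>s'\<in>UNIV. P $ s $ a $ s'))" for s
    unfolding policy_matrix_def sum_distrib_left by (rule sum.swap)
  then show ?thesis
    using assms
    by (auto simp: row_stochastic_def transition_kernel_def policies_def prob_simplex_def
        policy_matrix_def intro!: sum_nonneg mult_nonneg_nonneg)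
qed

lemma transition_op_policy_matrix:
  "transition_op (policy_matrix P p) h s = action_mean p (\<lambda>s a. \<Sum>s'\<in>UNIV. P $ s $ a $ s' * h s') s"
  unfolding transition_op_def policy_matrix_def action_mean_def sum_distrib_left sum_distrib_right
  by (subst sum.swap) (simp add: mult_ac)

lemma expectation_vec_pmf:
  fixes h :: "'n::finite \<Rightarrow> real"
  assumes "x \<in> prob_simplex"
  shows "measure_pmf.expectation (vec_pmf x) h = (\<Sum>i\<in>UNIV. x $ i * h i)"
  by (subst integral_measure_pmf[of UNIV]) (auto simp: pmf_vec_pmf[OF assms])

lemma expectation_step_pmf:
  assumes "transition_kernel P" "p \<in> policies"
  shows "measure_pmf.expectation (step_pmf P p s 0 x) (\<lambda>y. h (fst y) (snd y)) = action_mean p h s"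
    and "measure_pmf.expectation (step_pmf P p s (Suc t) x) (\<lambda>y. h (fst y) (snd y)) =
      (\<Sum>s'\<in>UNIV. P $ fst (x t) $ snd (x t) $ s' * action_mean p h s')"
proof -
  have p: "p $ s \<in> prob_simplex" for s using assms by (simp add: policies_def)
  have P: "P $ s $ a \<in> prob_simplex" for s a using assms by (simp add: transition_kernel_def)
  show "measure_pmf.expectation (step_pmf P p s 0 x) (\<lambda>y. h (fst y) (snd y)) = action_mean p h s"
    by (simp add: step_pmf_def bind_return_pmf expectation_vec_pmf[OF p] action_mean_def)
  show "measure_pmf.expectation (step_pmf P p s (Suc t) x) (\<lambda>y. h (fst y) (snd y)) =
      (\<Sum>s'\<in>UNIV. P $ fst (x t) $ snd (x t) $ s' * action_mean p h s')"
    by (simp add: step_pmf_def pmf_expectation_bind[of UNIV] pmf_vec_pmf[OF P]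
        expectation_vec_pmf[OF p] action_mean_def)
qed

text \<open>The induction removes the last transition by replacing h with its conditional
  expectation one step earlier. Hence h has to vary, and the new operator lands innermost and is
  commuted outwards at the end.\<close>

lemma expectation_marginal_pmf:
  assumes "transition_kernel P" "p \<in> policies"
  shows "measure_pmf.expectation (marginal_pmf P p s t) (\<lambda>y. h (fst y) (snd y)) =
    (transition_op (policy_matrix P p) ^^ t) (action_mean p h) s"
proof (induction t arbitrary: h)
  case 0
  show ?case by (simp add: expectation_step_pmf(1)[OF assms])
next
  case (Suc t)
  have "measure_pmf.expectation (marginal_pmf P p s (Suc t)) (\<lambda>y. h (fst y) (snd y)) =
      measure_pmf.expectation (marginal_pmf P p s t)
        (\<lambda>x. \<Sum>s'\<in>UNIV. P $ fst x $ snd x $ s' * action_mean p h s')"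
  proof -
    have "measure_pmf.expectation (marginal_pmf P p s (Suc t)) (\<lambda>y. h (fst y) (snd y)) =
        (\<Sum>x\<in>UNIV. pmf (marginal_pmf P p s t) x *\<^sub>R
          measure_pmf.expectation (step_pmf P p s (Suc t) (\<lambda>_. x)) (\<lambda>y. h (fst y) (snd y)))"
      unfolding marginal_pmf.simps by (rule pmf_expectation_bind) auto
    then show ?thesis
      unfolding expectation_step_pmf(2)[OF assms] by (subst integral_measure_pmf[of UNIV]) auto
  qed
  also have "\<dots> = (transition_op (policy_matrix P p) ^^ t)
      (transition_op (policy_matrix P p) (action_mean p h)) s"
    by (subst Suc[of "\<lambda>s a. \<Sum>s'\<in>UNIV. P $ s $ a $ s' * action_mean p h s'"])
      (simp add: transition_op_policy_matrix[abs_def, symmetric] flip: ext[OF transition_op_policy_matrix])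
  finally show ?case by (simp add: funpow_swap1)
qed

text \<open>Costs on a finite set are bounded, so a geometric series dominates the discounted sum
  and expectation and summation may be exchanged; each term then involves a single marginal.\<close>

lemma policy_value_eq_discounted:
  assumes P: "transition_kernel P" "p \<in> policies" and \<gamma>: "0 \<le> \<gamma>" "\<gamma> < 1"
  shows "policy_value c \<gamma> P p s = discounted \<gamma> (policy_matrix P p) (action_mean p c) s"
proof -
  interpret IT: Ionescu_Tulcea "\<lambda>t h. measure_pmf (step_pmf P p s t h)" "\<lambda>_. count_space UNIV"
    by (rule Ionescu_Tulcea_step_pmf)
  have lim: "trajectory P p s = IT.PF.lim"
    by (simp add: trajectory_def)
  have comp: "(\<lambda>\<omega>. \<omega> t) \<in> measurable (trajectory P p s) (count_space UNIV)" for t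
    unfolding lim measurable_cong_sets[OF IT.PF.sets_lim refl]
    by (rule measurable_component_singleton) simp
  \<comment> \<open>The total mass is read off from the marginal at time 0, since a push-forward
    preserves it.\<close>
  interpret prob_space "trajectory P p s"
  proof (rule prob_space_distrD[OF comp[of 0]])
    show "prob_space (distr (trajectory P p s) (count_space UNIV) (\<lambda>\<omega>. \<omega> 0))"
      unfolding distr_trajectory by (rule prob_space_measure_pmf)
  qed
  let ?f = "\<lambda>t \<omega>. \<gamma> ^ t * c (fst (\<omega> t)) (snd (\<omega> t))"
  define \<beta> where "\<beta> = (\<Sum>s\<in>UNIV. \<Sum>a\<in>UNIV. \<bar>c s a\<bar>)"
  have \<beta>: "\<bar>c s a\<bar> \<le> \<beta>" for s a
  proof -
    have "\<bar>c s a\<bar> \<le> (\<Sum>a\<in>UNIV. \<bar>c s a\<bar>)" by (rule member_le_sum) auto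
    also have "\<dots> \<le> \<beta>" unfolding \<beta>_def by (rule member_le_sum) (auto intro: sum_nonneg)
    finally show ?thesis .
  qed
  have bnd: "norm (?f t \<omega>) \<le> \<gamma> ^ t * \<beta>" for t \<omega>
    using \<gamma> \<beta> by (simp add: abs_mult mult_left_mono)
  have meas: "?f t \<in> borel_measurable (trajectory P p s)" for t
    using measurable_compose[OF comp, of "\<lambda>y. \<gamma> ^ t * c (fst y) (snd y)" borel t] by simp
  have int: "integrable (trajectory P p s) (?f t)" for t
    by (rule integrable_const_bound[OF _ meas]) (use bnd in auto)
  have sm: "summable (\<lambda>t. \<gamma> ^ t * \<beta>)"
    using \<gamma> by (intro summable_mult2 summable_geometric) auto
  have "policy_value c \<gamma> P p s = (\<Sum>t. \<integral>\<omega>. ?f t \<omega> \<partial>trajectory P p s)"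
    unfolding policy_value_def
  proof (rule integral_suminf[OF int])
    show "AE \<omega> in trajectory P p s. summable (\<lambda>t. norm (?f t \<omega>))"
      by (intro AE_I2 summable_comparison_test'[OF sm, of 0]) (simp only: norm_ge_zero abs_of_nonneg real_norm_def abs_abs bnd[unfolded real_norm_def])
    have "norm (\<integral>\<omega>. norm (?f t \<omega>) \<partial>trajectory P p s) \<le> \<gamma> ^ t * \<beta>" for t
    proof -
      have "(\<integral>\<omega>. norm (?f t \<omega>) \<partial>trajectory P p s) \<le> \<gamma> ^ t * \<beta>"
        using int bnd by (intro integral_le_const integrable_norm AE_I2)
      then show ?thesis by simp
    qed
    then show "summable (\<lambda>t. \<integral>\<omega>. norm (?f t \<omega>) \<partial>trajectory P p s)"
      by (rule summable_comparison_test'[OF sm, of 0])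
  qed
  also have "\<dots> = (\<Sum>t. \<gamma> ^ t * (transition_op (policy_matrix P p) ^^ t) (action_mean p c) s)"
  proof (rule suminf_cong)
    fix t
    have "(\<integral>\<omega>. c (fst (\<omega> t)) (snd (\<omega> t)) \<partial>trajectory P p s) =
        (\<integral>y. c (fst y) (snd y) \<partial>distr (trajectory P p s) (count_space UNIV) (\<lambda>\<omega>. \<omega> t))"
      by (rule integral_distr[OF comp, symmetric]) simp
    then show "(\<integral>\<omega>. ?f t \<omega> \<partial>trajectory P p s) =
        \<gamma> ^ t * (transition_op (policy_matrix P p) ^^ t) (action_mean p c) s"
      by (simp add: distr_trajectory expectation_marginal_pmf[OF P])
  qed
  finally show ?thesis by (simp add: discounted_def)
qed

section \<open>Policy gradients and their quadratic remainder\<close>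

definition action_value ::
  "('s::finite \<Rightarrow> 'a::finite \<Rightarrow> real) \<Rightarrow> real \<Rightarrow> ('s, 'a) kernel \<Rightarrow> ('s \<Rightarrow> real) \<Rightarrow> 's \<Rightarrow> 'a \<Rightarrow> real"
where
  "action_value c \<gamma> P V s a = c s a + \<gamma> * (\<Sum>s'\<in>UNIV. P $ s $ a $ s' * V s')"

text \<open>The policy gradient theorem: discounted expected number of visits times action value.\<close>

definition value_gradient ::
  "('s::finite \<Rightarrow> 'a::finite \<Rightarrow> real) \<Rightarrow> real \<Rightarrow> ('s, 'a) kernel \<Rightarrow> ('s, 'a) policy \<Rightarrow> 's \<Rightarrow> ('s, 'a) policy"
where
  "value_gradient c \<gamma> P p s0 =
     (\<chi> s a. discounted \<gamma> (policy_matrix P p) (indicator {s}) s0 *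
       action_value c \<gamma> P (policy_value c \<gamma> P p) s a)"

lemma action_mean_diff: "action_mean (p - q) h s = action_mean p h s - action_mean q h s"
  by (simp add: action_mean_def left_diff_distrib sum_subtractf)

lemma action_mean_diff_right:
  "action_mean p (\<lambda>s a. h s a - k s a) s = action_mean p h s - action_mean p k s"
  by (simp add: action_mean_def right_diff_distrib sum_subtractf)

lemma abs_action_mean_le:
  fixes \<delta> :: "('s::finite, 'a::finite) policy"
  assumes "\<And>s a. \<bar>h s a\<bar> \<le> \<beta>"
  shows "\<bar>action_mean \<delta> h s\<bar> \<le> real CARD('a) * norm \<delta> * \<beta>"
proof -
  have "\<bar>\<delta> $ s $ a * h s a\<bar> \<le> norm \<delta> * \<beta>" for a
  proof -
    have "\<bar>\<delta> $ s $ a\<bar> \<le> norm \<delta>"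
      using order_trans[OF Finite_Cartesian_Product.norm_nth_le[of "\<delta> $ s" a]
        Finite_Cartesian_Product.norm_nth_le[of \<delta> s]] by simp
    then show ?thesis using assms[of s a] by (simp add: abs_mult mult_mono)
  qed
  then have "(\<Sum>a\<in>UNIV. \<bar>\<delta> $ s $ a * h s a\<bar>) \<le> real CARD('a) * (norm \<delta> * \<beta>)"
    using sum_bounded_above[of "UNIV :: 'a set" "\<lambda>a. \<bar>\<delta> $ s $ a * h s a\<bar>" "norm \<delta> * \<beta>"] by simp
  then show ?thesis
    unfolding action_mean_def by (simp add: mult.assoc order_trans[OF sum_abs])
qed

lemma transition_op_sum:
  "transition_op M (\<lambda>s. \<Sum>i\<in>I. k i * h i s) s = (\<Sum>i\<in>I. k i * transition_op M (h i) s)"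
  unfolding transition_op_def sum_distrib_left by (subst sum.swap) (simp add: mult_ac)

lemma transition_op_diff:
  "transition_op M (\<lambda>s. h s - k s) s = transition_op M h s - transition_op M k s"
  by (simp add: transition_op_def right_diff_distrib sum_subtractf)

text \<open>Linearity of the resolvent in its source. With \<alpha> the mean action value along a
  direction, x is the inner product of the policy gradient with that direction, which thereby
  satisfies a discounted equation.\<close>

lemma discount_solution_superposition:
  fixes \<alpha> :: "'s::finite \<Rightarrow> real"
  assumes "row_stochastic M" "0 \<le> \<gamma>" "\<gamma> < 1"
  defines "x \<equiv> \<lambda>s0. \<Sum>s\<in>UNIV. \<alpha> s * discounted \<gamma> M (indicator {s}) s0"
  shows "x s = \<alpha> s + \<gamma> * transition_op M x s"
proof -
  have "x s = (\<Sum>s'\<in>UNIV. \<alpha> s' * indicator {s'} s) +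
      \<gamma> * (\<Sum>s'\<in>UNIV. \<alpha> s' * transition_op M (discounted \<gamma> M (indicator {s'})) s)"
    unfolding x_def
    by (subst discounted_unfold[OF assms(1-3)]) (simp add: sum.distrib distrib_left sum_distrib_left mult_ac)
  also have "(\<Sum>s'\<in>UNIV. \<alpha> s' * indicator {s'} s) = \<alpha> s"
    by (simp add: indicator_def eq_commute[of s] of_bool_def if_distrib sum.delta cong: if_cong)
  finally show ?thesis by (simp add: x_def transition_op_sum)
qed

locale discounted_mdp =
  fixes c :: "'s::finite \<Rightarrow> 'a::finite \<Rightarrow> real" and \<gamma> :: real
  assumes cost: "\<And>s a. 0 \<le> c s a" "\<And>s a. c s a \<le> 1" and \<gamma>: "0 \<le> \<gamma>" "\<gamma> < 1"
begin

lemma policy_value_unfold: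
  assumes "transition_kernel P" "p \<in> policies"
  shows "policy_value c \<gamma> P p s = action_mean p (action_value c \<gamma> P (policy_value c \<gamma> P p)) s"
proof -
  let ?V = "policy_value c \<gamma> P p"
  have V: "?V = discounted \<gamma> (policy_matrix P p) (action_mean p c)"
    using policy_value_eq_discounted[OF assms \<gamma>] by blast
  have "?V s = action_mean p c s + \<gamma> * transition_op (policy_matrix P p) ?V s"
    unfolding V by (rule discounted_unfold[OF row_stochastic_policy_matrix[OF assms] \<gamma>])
  also have "\<dots> = action_mean p (action_value c \<gamma> P ?V) s"
    unfolding transition_op_policy_matrix action_mean_def action_value_def distrib_left sum.distrib sum_distrib_left
    by (simp only: mult_ac)
  finally show ?thesis .
qed

lemma abs_policy_value_le:
  assumes "transition_kernel P" "p \<in> policies"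
  shows "\<bar>policy_value c \<gamma> P p s\<bar> \<le> 1 / (1 - \<gamma>)"
proof -
  have "\<bar>action_mean p c s\<bar> \<le> 1" for s
    unfolding action_mean_def using assms cost
    by (intro prob_simplex_abs_sum_le) (auto simp: policies_def abs_le_iff intro: order_trans[of _ 0])
  then show ?thesis
    using policy_value_eq_discounted[OF assms \<gamma>]
      discounted_bound[OF row_stochastic_policy_matrix[OF assms] \<gamma>] by metis
qed

lemma abs_action_value_le:
  assumes "transition_kernel P" "\<And>s. \<bar>V s\<bar> \<le> 1 / (1 - \<gamma>)"
  shows "\<bar>action_value c \<gamma> P V s a\<bar> \<le> 1 / (1 - \<gamma>)"
proof -
  have "\<bar>\<Sum>s'\<in>UNIV. P $ s $ a $ s' * V s'\<bar> \<le> 1 / (1 - \<gamma>)"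
    using assms by (intro prob_simplex_abs_sum_le) (auto simp: transition_kernel_def)
  then have "\<gamma> * \<bar>\<Sum>s'\<in>UNIV. P $ s $ a $ s' * V s'\<bar> \<le> \<gamma> * (1 / (1 - \<gamma>))"
    using \<gamma> by (intro mult_left_mono) auto
  then have "\<bar>action_value c \<gamma> P V s a\<bar> \<le> 1 + \<gamma> * (1 / (1 - \<gamma>))"
    unfolding action_value_def using cost[of s a] \<gamma>
    by (intro order_trans[OF abs_triangle_ineq] add_mono) (auto simp: abs_mult)
  also have "\<dots> = 1 / (1 - \<gamma>)" using \<gamma> by (simp add: field_simps)
  finally show ?thesis .
qed

lemma inner_value_gradient:
  "value_gradient c \<gamma> P p s0 \<bullet> \<delta> =
    (\<Sum>s\<in>UNIV. action_mean \<delta> (action_value c \<gamma> P (policy_value c \<gamma> P p)) s *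
      discounted \<gamma> (policy_matrix P p) (indicator {s}) s0)"
  unfolding value_gradient_def inner_vec_def action_mean_def sum_distrib_right
  by (simp add: mult_ac)

lemma norm_value_gradient_le:
  assumes "transition_kernel P" "p \<in> policies"
  shows "norm (value_gradient c \<gamma> P p s0) \<le> real CARD('s) * real CARD('a) / (1 - \<gamma>)^2"
proof -
  have entry: "\<bar>value_gradient c \<gamma> P p s0 $ s $ a\<bar> \<le> 1 / (1 - \<gamma>)^2" for s a
  proof -
    have "\<bar>discounted \<gamma> (policy_matrix P p) (indicator {s}) s0\<bar> \<le> 1 / (1 - \<gamma>)"
      by (rule discounted_bound[OF row_stochastic_policy_matrix[OF assms] \<gamma>]) (simp add: indicator_def)
    moreover have "\<bar>action_value c \<gamma> P (policy_value c \<gamma> P p) s a\<bar> \<le> 1 / (1 - \<gamma>)"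
      by (rule abs_action_value_le[OF assms(1) abs_policy_value_le[OF assms]])
    ultimately have "\<bar>value_gradient c \<gamma> P p s0 $ s $ a\<bar> \<le> (1 / (1 - \<gamma>)) * (1 / (1 - \<gamma>))"
      unfolding value_gradient_def using \<gamma> by (simp only: abs_mult vec_lambda_beta) (intro mult_mono, auto)
    then show ?thesis by (simp add: power2_eq_square)
  qed
  have "norm (value_gradient c \<gamma> P p s0) \<le> (\<Sum>s\<in>UNIV. norm (value_gradient c \<gamma> P p s0 $ s))"
    unfolding norm_vec_def by (rule L2_set_le_sum) simp
  also have "\<dots> \<le> (\<Sum>s\<in>UNIV. \<Sum>a\<in>UNIV. \<bar>value_gradient c \<gamma> P p s0 $ s $ a\<bar>)"
    by (intro sum_mono norm_le_l1_cart)
  also have "\<dots> \<le> (\<Sum>s\<in>(UNIV :: 's set). \<Sum>a\<in>(UNIV :: 'a set). 1 / (1 - \<gamma>)^2)"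
    by (intro sum_mono entry)
  finally show ?thesis by simp
qed

text \<open>The increment W and its linear part G solve discounted equations with the same source,
  but with the matrices of q and of p respectively. Their difference solves the equation for p with
  the source \<open>\<gamma> * action_mean \<delta> PW\<close>, a product of \<delta> and W and
  hence quadratic in \<delta>. The constant collects two factors |A| * |\<delta>|, two powers of
  1/(1 - \<gamma>) from the bound on W and one from the last equation.\<close>

lemma policy_value_expansion:
  assumes P: "transition_kernel P" and p: "p \<in> policies" and q: "q \<in> policies"
  shows "\<bar>policy_value c \<gamma> P q s - policy_value c \<gamma> P p s - value_gradient c \<gamma> P p s \<bullet> (q - p)\<bar>
    \<le> (real CARD('a))^2 / (1 - \<gamma>)^3 * (norm (q - p))^2"
proof -
  define \<delta> where "\<delta> = q - p"
  define V where "V = policy_value c \<gamma> P p"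
  define W where "W = (\<lambda>s. policy_value c \<gamma> P q s - V s)"
  define G where "G = (\<lambda>s. value_gradient c \<gamma> P p s \<bullet> \<delta>)"
  define PW where "PW = (\<lambda>s a. \<Sum>s'\<in>UNIV. P $ s $ a $ s' * W s')"
  define n where "n = real CARD('a) * norm \<delta>"
  have n: "n \<ge> 0" by (simp add: n_def)
  note stp = row_stochastic_policy_matrix[OF P p] and stq = row_stochastic_policy_matrix[OF P q]
  have PWq: "\<gamma> * PW s a = action_value c \<gamma> P (policy_value c \<gamma> P q) s a - action_value c \<gamma> P V s a" for s a
    by (simp add: PW_def action_value_def W_def right_diff_distrib sum_subtractf)
  have scale: "action_mean r (\<lambda>s a. \<gamma> * PW s a) s = \<gamma> * action_mean r PW s" for r :: "('s, 'a) policy" and s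
    by (simp add: action_mean_def sum_distrib_left mult_ac)
  \<comment> \<open>Performance difference: the change of policy is charged to the old action
    values, and the change of values is propagated by the new policy.\<close>
  have W: "W s = action_mean \<delta> (action_value c \<gamma> P V) s + \<gamma> * action_mean q PW s" for s
  proof -
    have "W s = action_mean q (action_value c \<gamma> P (policy_value c \<gamma> P q)) s - action_mean p (action_value c \<gamma> P V) s"
      using policy_value_unfold[OF P q] policy_value_unfold[OF P p] by (simp add: W_def V_def)
    then show ?thesis
      unfolding scale[symmetric] PWq by (simp add: action_mean_diff_right \<delta>_def action_mean_diff)
  qed
  have Wtrans: "transition_op (policy_matrix P r) W s = action_mean r PW s" for r s
    unfolding transition_op_policy_matrix PW_def ..
  have Wt: "W s = action_mean \<delta> (action_value c \<gamma> P V) s + \<gamma> * transition_op (policy_matrix P q) W s" for s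
    unfolding Wtrans by (rule W)
  have G: "G s = action_mean \<delta> (action_value c \<gamma> P V) s + \<gamma> * transition_op (policy_matrix P p) G s" for s
    using discount_solution_superposition[OF stp \<gamma>, of "action_mean \<delta> (action_value c \<gamma> P V)" s]
    unfolding G_def inner_value_gradient V_def .
  have Vb: "\<bar>V s\<bar> \<le> 1 / (1 - \<gamma>)" for s
    unfolding V_def by (rule abs_policy_value_le[OF P p])
  have "\<bar>action_mean \<delta> (action_value c \<gamma> P V) s\<bar> \<le> n / (1 - \<gamma>)" for s
    using abs_action_mean_le[OF abs_action_value_le[OF P Vb], where \<delta> = \<delta> and s = s] by (simp add: n_def)
  from discount_equation_bound[OF stq \<gamma> Wt this]
  have Wb: "\<bar>W s\<bar> \<le> n / (1 - \<gamma>)^2" for s by (simp add: power2_eq_square)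
  have PWb: "\<bar>PW s a\<bar> \<le> n / (1 - \<gamma>)^2" for s a
    unfolding PW_def using P Wb by (intro prob_simplex_abs_sum_le) (auto simp: transition_kernel_def)
  \<comment> \<open>Passing from the matrix of q to that of p in the equation for W costs exactly
    the mean of \<open>PW\<close> along \<delta>.\<close>
  have Z: "W s - G s = \<gamma> * action_mean \<delta> PW s + \<gamma> * transition_op (policy_matrix P p) (\<lambda>s. W s - G s) s" for s
  proof -
    have "action_mean \<delta> PW s = action_mean q PW s - action_mean p PW s"
      unfolding \<delta>_def by (rule action_mean_diff)
    then have "\<gamma> * action_mean q PW s = \<gamma> * action_mean \<delta> PW s + \<gamma> * action_mean p PW s"
      by (simp add: right_diff_distrib)
    with W[of s] G[of s] show ?thesis
      unfolding transition_op_diff Wtrans right_diff_distrib by linarith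
  qed
  have "\<bar>\<gamma> * action_mean \<delta> PW s\<bar> \<le> n * (n / (1 - \<gamma>)^2)" for s
  proof -
    have "\<bar>\<gamma> * action_mean \<delta> PW s\<bar> \<le> 1 * \<bar>action_mean \<delta> PW s\<bar>"
      unfolding abs_mult using \<gamma> by (intro mult_right_mono) auto
    also have "\<dots> \<le> n * (n / (1 - \<gamma>)^2)"
      using abs_action_mean_le[OF PWb, where \<delta> = \<delta> and s = s] by (simp add: n_def)
    finally show ?thesis .
  qed
  from discount_equation_bound[OF stp \<gamma> Z this, of s]
  have "\<bar>W s - G s\<bar> \<le> n * (n / (1 - \<gamma>)^2) / (1 - \<gamma>)" .
  then show ?thesis
    by (simp add: W_def G_def V_def \<delta>_def n_def power2_eq_square power3_eq_cube mult_ac)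
qed

lemma continuous_on_policy_value:
  assumes "\<And>u. u \<in> U \<Longrightarrow> transition_kernel (PN + u)" "p \<in> policies"
  shows "continuous_on U (\<lambda>u. policy_value c \<gamma> (PN + u) p s)"
proof -
  have "continuous_on U (\<lambda>u. discounted \<gamma> (policy_matrix (PN + u) p) (action_mean p c) s)"
    by (rule continuous_on_discounted[OF _ \<gamma>])
      (auto simp: policy_matrix_def intro!: continuous_intros row_stochastic_policy_matrix assms)
  then show ?thesis
    by (rule continuous_on_eq) (simp add: policy_value_eq_discounted[OF assms(1) assms(2) \<gamma>])
qed

lemma continuous_on_value_gradient:
  assumes "\<And>u. u \<in> U \<Longrightarrow> transition_kernel (PN + u)" "p \<in> policies"
  shows "continuous_on U (\<lambda>u. value_gradient c \<gamma> (PN + u) p s)"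
  unfolding value_gradient_def action_value_def
proof (intro continuous_intros continuous_on_policy_value assms)
  fix s'
  show "continuous_on U (\<lambda>u. discounted \<gamma> (policy_matrix (PN + u) p) (indicator {s'}) s)"
    by (rule continuous_on_discounted[OF _ \<gamma>])
      (auto simp: policy_matrix_def intro!: continuous_intros row_stochastic_policy_matrix assms)
qed

end

section \<open>Differentiability of the robust objective\<close>

definition tangent_space :: "('s::finite, 'a::finite) policy set" where
  "tangent_space = {\<delta>. \<forall>s. (\<Sum>a\<in>UNIV. \<delta> $ s $ a) = 0}"

lemma subspace_tangent_space: "subspace tangent_space"
  by (auto simp: subspace_def tangent_space_def sum.distrib simp flip: sum_distrib_left)

lemma policies_diff_tangent:
  assumes "p \<in> policies" "q \<in> policies"
  shows "q - p \<in> tangent_space"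
  using assms by (simp add: tangent_space_def policies_def prob_simplex_def sum_subtractf)

text \<open>Row sums zero determine the entry at a reference action a0 from the others, so the
  vectors e_(s,a) - e_(s,a0) with a different from a0 span. An upper bound is enough, because the
  null set theorem asks only for \<open>card B \<le> d\<close>.\<close>

lemma dim_tangent_space_le:
  "dim (tangent_space :: ('s::finite, 'a::finite) policy set) \<le> (CARD('a) - 1) * CARD('s)"
proof -
  fix a0 :: 'a
  define e :: "'s \<times> 'a \<Rightarrow> ('s, 'a) policy" where "e = (\<lambda>(s, a). axis s (axis a 1 - axis a0 1))"
  define I where "I = (UNIV :: 's set) \<times> (UNIV - {a0})"
  have "\<delta> \<in> span (e ` I)" if "\<delta> \<in> tangent_space" for \<delta>
  proof -
    have entry: "\<delta> $ t $ b = (\<Sum>i\<in>I. \<delta> $ fst i $ snd i * e i $ t $ b)" for t b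
    proof -
      have "(\<Sum>i\<in>I. \<delta> $ fst i $ snd i * e i $ t $ b) =
          (\<Sum>s\<in>UNIV. \<Sum>a\<in>UNIV - {a0}. \<delta> $ s $ a * e (s, a) $ t $ b)"
        unfolding I_def by (subst sum.cartesian_product) (simp add: case_prod_unfold)
      also have "\<dots> = (\<Sum>s\<in>UNIV. if s = t then \<Sum>a\<in>UNIV - {a0}. \<delta> $ s $ a * (axis a 1 - axis a0 1) $ b else 0)"
        by (intro sum.cong refl) (auto simp: e_def axis_def)
      also have "\<dots> = (\<Sum>a\<in>UNIV - {a0}. \<delta> $ t $ a * (axis a 1 - axis a0 1) $ b)"
        by simp
      also have "\<dots> = \<delta> $ t $ b"
      proof (cases "b = a0")
        case True
        have "(\<Sum>a\<in>UNIV - {a0}. \<delta> $ t $ a * (axis a 1 - axis a0 1) $ b) = - (\<Sum>a\<in>UNIV - {a0}. \<delta> $ t $ a)"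
          unfolding sum_negf[symmetric] using True by (intro sum.cong) (auto simp: axis_def)
        also have "\<dots> = \<delta> $ t $ a0"
          using that sum.remove[of UNIV a0 "\<lambda>a. \<delta> $ t $ a"] by (simp add: tangent_space_def)
        finally show ?thesis using True by simp
      next
        case False
        have "(\<Sum>a\<in>UNIV - {a0}. \<delta> $ t $ a * (axis a 1 - axis a0 1) $ b) =
            (\<Sum>a\<in>UNIV - {a0}. if a = b then \<delta> $ t $ a else 0)"
          using False by (intro sum.cong) (auto simp: axis_def)
        then show ?thesis using False by simp
      qed
      finally show ?thesis by simp
    qed
    have "\<delta> = (\<Sum>i\<in>I. (\<delta> $ fst i $ snd i) *\<^sub>R e i)"
      unfolding vec_eq_iff sum_component vector_scaleR_component real_scaleR_def
      by (intro allI entry)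
    also have "\<dots> \<in> span (e ` I)"
      by (intro span_sum span_scale span_base) auto
    finally show ?thesis .
  qed
  then have "dim (tangent_space :: ('s, 'a) policy set) \<le> card (e ` I)"
    by (intro dim_le_card) auto
  also have "\<dots> \<le> card I" by (rule card_image_le) simp
  also have "\<dots> = (CARD('a) - 1) * CARD('s)"
    by (simp add: I_def card_cartesian_product)
  finally show ?thesis .
qed

text \<open>The residual quotient of the sum is dominated by the sum of the individual quotients
  with weights |w i|.\<close>

lemma policy_differentiable_weighted_sum:
  fixes f :: "'i \<Rightarrow> ('s::finite, 'a::finite) policy \<Rightarrow> real"
  assumes "finite I" "\<And>i. i \<in> I \<Longrightarrow> policy_differentiable (f i) p"
  shows "policy_differentiable (\<lambda>p. \<Sum>i\<in>I. w i * f i p) p"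
proof -
  obtain G where G: "\<And>i. i \<in> I \<Longrightarrow> is_policy_gradient (f i) p (G i)"
    using assms(2) unfolding policy_differentiable_def by metis
  let ?F = "at 0 within {\<delta>. p + \<delta> \<in> policies}"
  let ?r = "\<lambda>i \<delta>. \<bar>f i (p + \<delta>) - f i p - G i \<bullet> \<delta>\<bar> / norm \<delta>"
  have "((\<lambda>\<delta>. \<Sum>i\<in>I. \<bar>w i\<bar> * ?r i \<delta>) \<longlongrightarrow> (\<Sum>i\<in>I. \<bar>w i\<bar> * 0)) ?F"
    using G by (intro tendsto_sum tendsto_mult_left) (simp add: is_policy_gradient_def)
  then have lim: "((\<lambda>\<delta>. \<Sum>i\<in>I. \<bar>w i\<bar> * ?r i \<delta>) \<longlongrightarrow> 0) ?F" by simp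
  have "is_policy_gradient (\<lambda>p. \<Sum>i\<in>I. w i * f i p) p (\<Sum>i\<in>I. w i *\<^sub>R G i)"
    unfolding is_policy_gradient_def
  proof (rule Lim_null_comparison[OF _ lim], intro always_eventually allI)
    fix \<delta> :: "('s, 'a) policy"
    have "(\<Sum>i\<in>I. w i * f i (p + \<delta>)) - (\<Sum>i\<in>I. w i * f i p) - (\<Sum>i\<in>I. w i *\<^sub>R G i) \<bullet> \<delta> =
        (\<Sum>i\<in>I. w i * (f i (p + \<delta>) - f i p - G i \<bullet> \<delta>))"
      by (simp add: inner_sum_left right_diff_distrib sum_subtractf)
    also have "\<bar>\<dots>\<bar> / norm \<delta> \<le> (\<Sum>i\<in>I. \<bar>w i * (f i (p + \<delta>) - f i p - G i \<bullet> \<delta>)\<bar>) / norm \<delta>"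
      by (intro divide_right_mono sum_abs) simp
    also have "\<dots> = (\<Sum>i\<in>I. \<bar>w i\<bar> * ?r i \<delta>)"
      by (simp add: sum_divide_distrib abs_mult)
    finally show "norm (\<bar>(\<Sum>i\<in>I. w i * f i (p + \<delta>)) - (\<Sum>i\<in>I. w i * f i p) - (\<Sum>i\<in>I. w i *\<^sub>R G i) \<bullet> \<delta>\<bar> / norm \<delta>)
        \<le> (\<Sum>i\<in>I. \<bar>w i\<bar> * ?r i \<delta>)"
      by simp
  qed
  then show ?thesis by (auto simp: policy_differentiable_def)
qed

theorem lemma2p3:
  fixes c :: "'s::finite \<Rightarrow> 'a::finite \<Rightarrow> real"
    and \<gamma> :: real
    and PN :: "('s, 'a) kernel"
    and U :: "('s, 'a) kernel set"
    and \<rho> :: "'s pmf"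
  assumes "\<And>s a. 0 < c s a \<and> c s a \<le> 1"
    and "0 < \<gamma>" and "\<gamma> < 1"
    and "transition_kernel PN"
    and "U \<noteq> {}" and "compact U" and "sa_rectangular U"
    and "\<And>u. u \<in> U \<Longrightarrow> transition_kernel (PN + u)"
  shows "hausdorff_measure ((CARD('a) - 1) * CARD('s))
           {p \<in> policies. \<not> policy_differentiable (robust_objective c \<gamma> PN U \<rho>) p} = 0"
proof -
  let ?d = "(CARD('a) - 1) * CARD('s)"
  interpret discounted_mdp c \<gamma>
    using assms(1-3) by unfold_locales (auto intro: less_imp_le)
  obtain B :: "('s, 'a) policy set" where B: "pairwise orthogonal B" "\<And>b. b \<in> B \<Longrightarrow> norm b = 1"
    "independent B" "card B = dim (tangent_space :: ('s, 'a) policy set)" "span B = tangent_space"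
    using orthonormal_basis_subspace[OF subspace_tangent_space] by metis
  have d: "card B \<le> ?d" using B(4) dim_tangent_space_le by simp
  \<comment> \<open>One state at a time: for fixed s the robust value is \<open>upper\<close> of one
    smooth family, whose constants come from the resolvent bounds and do not depend on u.\<close>
  have null: "hausdorff_measure ?d
      {p \<in> policies. \<not> policy_differentiable (\<lambda>p. robust_value c \<gamma> PN U p s) p} = 0" for s
  proof -
    interpret smooth_family_max policies U "\<lambda>u p. policy_value c \<gamma> (PN + u) p s"
      "\<lambda>u p. value_gradient c \<gamma> (PN + u) p s" "(real CARD('a))^2 / (1 - \<gamma>)^3"
      "real CARD('s) * real CARD('a) / (1 - \<gamma>)^2" B
    proof
      show "compact U" "U \<noteq> {}" by fact+
      show "0 \<le> (real CARD('a))\<^sup>2 / (1 - \<gamma>) ^ 3" using assms(3) by simp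
      show "finite B" using B(3) by (rule independent_imp_finite)
      show "pairwise orthogonal B" by fact
      show "norm b = 1" if "b \<in> B" for b by (rule B(2)[OF that])
      show "q - p \<in> span B" if "p \<in> policies" "q \<in> policies" for p q
        unfolding B(5) by (rule policies_diff_tangent[OF that])
      fix p :: "('s, 'a) policy" assume p: "p \<in> policies"
      show "continuous_on U (\<lambda>u. policy_value c \<gamma> (PN + u) p s)"
        by (rule continuous_on_policy_value[OF assms(8) p])
      show "continuous_on U (\<lambda>u. value_gradient c \<gamma> (PN + u) p s)"
        by (rule continuous_on_value_gradient[OF assms(8) p])
      fix u assume u: "u \<in> U"
      show "norm (value_gradient c \<gamma> (PN + u) p s) \<le> real CARD('s) * real CARD('a) / (1 - \<gamma>)\<^sup>2"
        by (rule norm_value_gradient_le[OF assms(8)[OF u] p])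
      show "\<bar>policy_value c \<gamma> (PN + u) q s - policy_value c \<gamma> (PN + u) p s -
          value_gradient c \<gamma> (PN + u) p s \<bullet> (q - p)\<bar> \<le> (real CARD('a))\<^sup>2 / (1 - \<gamma>) ^ 3 * (norm (q - p))\<^sup>2"
        if "q \<in> policies" for q
        by (rule policy_value_expansion[OF assms(8)[OF u] p that])
    qed
    show ?thesis
      using hausdorff_measure_not_differentiable_upper[OF d]
      unfolding policy_differentiable_def is_policy_gradient_def robust_value_def upper_def .
  qed
  have "robust_objective c \<gamma> PN U \<rho> = (\<lambda>p. \<Sum>s\<in>UNIV. pmf \<rho> s * robust_value c \<gamma> PN U p s)"
    unfolding robust_objective_def by (subst integral_measure_pmf[of UNIV]) auto
  then have "policy_differentiable (robust_objective c \<gamma> PN U \<rho>) p"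
    if "\<And>s. policy_differentiable (\<lambda>p. robust_value c \<gamma> PN U p s) p" for p
    using policy_differentiable_weighted_sum[of UNIV "\<lambda>s p. robust_value c \<gamma> PN U p s" p "pmf \<rho>"] that
    by simp
  \<comment> \<open>By contraposition: the \<rho>-average is a finite weighted sum, so where it
    fails to be differentiable, the robust value of some state fails as well.\<close>
  then have sub: "{p \<in> policies. \<not> policy_differentiable (robust_objective c \<gamma> PN U \<rho>) p} \<subseteq>
      (\<Union>s\<in>UNIV. {p \<in> policies. \<not> policy_differentiable (\<lambda>p. robust_value c \<gamma> PN U p s) p})"
    by blast
  have "hausdorff_measure ?d
      (\<Union>s\<in>UNIV. {p \<in> policies. \<not> policy_differentiable (\<lambda>p. robust_value c \<gamma> PN U p s) p}) = 0"
    by (rule hausdorff_measure_eq_0_UN[OF countable_finite[OF finite] null])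
  from this sub show ?thesis by (rule hausdorff_measure_eq_0_subset)
qed

end
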